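(* Fix an integer $d\ge 1$. For every integer $i\ge 1$, let $V_{\ge i}$ be the set of vertices of degree at least $i$ in the $d$-NN tree $G_n$. There are constants $C_1=C_1(d)>0$, $C_2=C_2(d)>C_1$ and $c=c(d)>0$ such that asymptotically almost surely, for every $i\le c\log n$, we have $$n\exp(-C_2 i)\le |V_{\ge i}|\le n\exp(-C_1 i)\qquad\text{and}\qquad |V_{\ge i}|=(1+o(1))\,\mathbb E|V_{\ge i}| .$$
   Context: Here $\log$ is the natural logarithm, and "asymptotically almost surely" means with probability tending to $1$ as $n\to\infty$. Let $\mathbb T^d_n$ be the $d$-dimensional torus of volume $n$ (that is, $\mathbb R^d/(n^{1/d}\mathbb Z)^d$) with the metric inherited from the Euclidean metric. The $d$-NN tree $G_n$: vertices $0,1,\dots,n-1$ arrive one by one, each vertex being placed at a uniformly random point of $\mathbb T^d_n$, independently of all others; each vertex $v\ge 1$ is connected upon arrival by an edge to the closest vertex among $\{0,\dots,v-1\}$ in the torus metric (ties have probability $0$).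
   Formalization: The upper bound |V_{≥i}| ≤ n exp(-C_1 i) is claimed only for 2 ≤ i ≤ c log n: at i = 1 it is false, since for n ≥ 2 every vertex has degree at least 1 and so |V_{≥1}| = n. The lower bound and the (1+o(1)) claim are kept for all 1 ≤ i ≤ c log n. *)

theory Defs
  imports "HOL-Probability.Probability"
begin

text \<open>
  The torus \<open>\<real>\<^sup>d / (n\<^sup>1\<^sup>/\<^sup>d \<int>)\<^sup>d\<close> is represented by its half-open fundamental cube, on which the
  quotient metric is the minimal Euclidean distance over all lattice translates. The dimension
  \<open>d\<close> is \<open>CARD('d)\<close>.
\<close>

definition torus_side :: "'d::finite itself \<Rightarrow> nat \<Rightarrow> real" where
  "torus_side _ n = root CARD('d) (real n)"

definition torus :: "nat \<Rightarrow> (real ^ 'd::finite) set" where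
  "torus n = {x. \<forall>j. 0 \<le> x $ j \<and> x $ j < torus_side TYPE('d) n}"

definition torus_dist :: "nat \<Rightarrow> real ^ 'd::finite \<Rightarrow> real ^ 'd \<Rightarrow> real" where
  "torus_dist n x y =
     (INF k \<in> {k :: real ^ 'd. \<forall>j. k $ j \<in> \<int>}. norm (x - y + torus_side TYPE('d) n *\<^sub>R k))"

definition arrivals :: "nat \<Rightarrow> (nat \<Rightarrow> real ^ 'd::finite) measure" where
  "arrivals n = PiM {..<n} (\<lambda>_. uniform_measure lborel (torus n))"

text \<open>
  \<open>X v\<close> is the position of vertex \<open>v\<close>. The least index breaks ties, which occur with
  probability zero.
\<close>

definition nearest_earlier :: "nat \<Rightarrow> (nat \<Rightarrow> real ^ 'd::finite) \<Rightarrow> nat \<Rightarrow> nat" where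
  "nearest_earlier n X v =
     (LEAST u. u < v \<and> (\<forall>w<v. torus_dist n (X v) (X u) \<le> torus_dist n (X v) (X w)))"

definition NN_tree_edges :: "nat \<Rightarrow> (nat \<Rightarrow> real ^ 'd::finite) \<Rightarrow> nat set set" where
  "NN_tree_edges n X = {{nearest_earlier n X v, v} | v. 1 \<le> v \<and> v < n}"

definition NN_degree :: "nat \<Rightarrow> (nat \<Rightarrow> real ^ 'd::finite) \<Rightarrow> nat \<Rightarrow> nat" where
  "NN_degree n X v = card {e \<in> NN_tree_edges n X. v \<in> e}"

definition V_ge :: "nat \<Rightarrow> nat \<Rightarrow> (nat \<Rightarrow> real ^ 'd::finite) \<Rightarrow> nat set" where
  "V_ge n i X = {v. v < n \<and> i \<le> NN_degree n X v}"

definition expected_V_ge :: "'d::finite itself \<Rightarrow> nat \<Rightarrow> nat \<Rightarrow> real" where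
  "expected_V_ge _ n i = (LINT X | (arrivals n :: (nat \<Rightarrow> real ^ 'd) measure). real (card (V_ge n i X)))"

definition asymptotically_almost_surely ::
    "(nat \<Rightarrow> 'a measure) \<Rightarrow> (nat \<Rightarrow> 'a \<Rightarrow> bool) \<Rightarrow> bool" where
  "asymptotically_almost_surely M P \<longleftrightarrow>
     (\<lambda>n. measure (M n) {x \<in> space (M n). P n x}) \<longlonglongrightarrow> 1"

end

theory Submission imports Defs "HOL-Real_Asymp.Real_Asymp"
begin

text \<open>
  Everything follows from exchangeability of the points and one geometric fact: among finitely many
  points only a bounded number \<open>\<kappa>\<close> can have the same point \<open>v\<close> as nearest neighbour. Given the set of
  the first \<open>w + 1\<close> points, the last arrival is uniformly distributed, so it attaches to \<open>v\<close> with
  conditional probability at most \<open>\<kappa> / w\<close>. Revealing the order backwards gives, for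
  \<open>\<beta> = 1 + 1 / (2 \<kappa>)\<close>, that \<open>\<beta>\<close> to the power of the number of children of \<open>v\<close> has expectation
  \<open>O(sqrt (n / (v + 1)))\<close>, whose sum over \<open>v\<close> is \<open>O(n)\<close>. This yields the exponential upper bound on
  the expectation of \<open>|V\<^bsub>\<ge> i\<^esub>|\<close>.

  Removing one vertex changes \<open>|V\<^bsub>\<ge> i\<^esub>|\<close> by at most two plus its number of children, so by the
  Efron--Stein inequality the variance of \<open>|V\<^bsub>\<ge> i\<^esub>|\<close> is \<open>O(n)\<close>, and Chebyshev's inequality with a union
  bound over the \<open>O(log n)\<close> values of \<open>i\<close> gives the concentration.

  For the lower bound, the first \<open>m = n exp (- 2 i - O(1))\<close> vertices have on average at least
  \<open>ln (n / m)\<close> children, again by exchangeability, and the exponential moment turns this mean into a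
  positive proportion of vertices with at least \<open>i\<close> children. Finally, there are \<open>n - 1\<close> edges, so
  \<open>|V\<^bsub>\<ge> 2\<^esub>| + |V\<^bsub>\<ge> 3\<^esub>| \<le> n\<close>, which handles bounded \<open>i\<close> in the upper bound.
\<close>

section \<open>The Efron--Stein inequality\<close>

text \<open>This is nonnegativity of the variance of \<open>h\<close>; below it says that averaging
  over one coordinate does not increase an L2 distance.\<close>

lemma (in prob_space) square_integral_le:
  fixes h :: "'a \<Rightarrow> real"
  assumes [measurable]: "h \<in> borel_measurable M" and B: "\<And>x. x \<in> space M \<Longrightarrow> \<bar>h x\<bar> \<le> B"
  shows "(\<integral>x. h x \<partial>M)\<^sup>2 \<le> (\<integral>x. (h x)\<^sup>2 \<partial>M)"
proof -
  have 1: "integrable M h"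
    by (rule integrable_const_bound[of _ B]) (auto intro: B)
  have 2: "integrable M (\<lambda>x. (h x)\<^sup>2)"
    by (rule integrable_const_bound[of _ "B\<^sup>2"]) (auto intro: B simp: abs_le_square_iff[symmetric] order.trans[OF B abs_ge_self])
  show ?thesis
    using variance_positive[of h] variance_eq[OF 1 2] by linarith
qed

text \<open>Induction on the coordinates: averaging over the new one splits the variance into the
  variance of the average, covered by the induction hypothesis, and a mean conditional variance.
  Each comparison function \<open>g u\<close> is merely blind to coordinate \<open>u\<close>, rather
  than an independent resampling of it, which suits the deletion of a vertex.\<close>

lemma efron_stein:
  fixes f :: "('i \<Rightarrow> 'a) \<Rightarrow> real" and g :: "'i \<Rightarrow> ('i \<Rightarrow> 'a) \<Rightarrow> real"
  assumes M: "\<And>i. prob_space (M i)" and "finite I"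
    and "f \<in> borel_measurable (PiM I M)" and "\<And>x. x \<in> space (PiM I M) \<Longrightarrow> \<bar>f x\<bar> \<le> B"
    and "\<And>u. u \<in> I \<Longrightarrow> g u \<in> borel_measurable (PiM I M)"
    and "\<And>u x. u \<in> I \<Longrightarrow> x \<in> space (PiM I M) \<Longrightarrow> \<bar>g u x\<bar> \<le> B"
    and "\<And>u x y. u \<in> I \<Longrightarrow> x \<in> space (PiM I M) \<Longrightarrow> y \<in> space (M u) \<Longrightarrow> g u (x(u := y)) = g u x"
  shows "(\<integral>x. (f x)\<^sup>2 \<partial>PiM I M) - (\<integral>x. f x \<partial>PiM I M)\<^sup>2 \<le> (\<Sum>u\<in>I. \<integral>x. (f x - g u x)\<^sup>2 \<partial>PiM I M)"
  using assms(2-)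
proof (induction I arbitrary: f g rule: finite_induct)
  case empty
  interpret E: prob_space "PiM {} M" by (intro prob_space_PiM M)
  have "(\<integral>x. (f x) \<partial>PiM {} M) = f (\<lambda>_. undefined)" for f :: "('i \<Rightarrow> 'a) \<Rightarrow> real"
  proof -
    have "(\<integral>x. f x \<partial>PiM {} M) = (\<integral>x. f (\<lambda>_. undefined) \<partial>PiM {} M)"
      by (rule Bochner_Integration.integral_cong) (auto simp: space_PiM)
    then show ?thesis by (simp add: E.prob_space)
  qed
  then show ?case by simp
next
  case (insert u I)
  interpret product_sigma_finite M
    using M by (auto simp: product_sigma_finite_def prob_space_imp_sigma_finite)
  interpret Mu: prob_space "M u" by (rule M)
  interpret PI: prob_space "PiM I M" by (intro prob_space_PiM M)
  interpret PuI: prob_space "PiM (insert u I) M" by (intro prob_space_PiM M)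
  have upd: "x(u := y) \<in> space (PiM (insert u I) M)" if "x \<in> space (PiM I M)" "y \<in> space (M u)" for x y
    using that by (auto simp: space_PiM PiE_def extensional_def Pi_def)
  have meas2: "(\<lambda>(x,y). h (x(u := y))) \<in> borel_measurable (PiM I M \<Otimes>\<^sub>M M u)"
    if "h \<in> borel_measurable (PiM (insert u I) M)" for h :: "('i \<Rightarrow> 'a) \<Rightarrow> real"
    using measurable_compose[OF measurable_add_dim that] by (simp add: case_prod_unfold)
  have meas1: "(\<lambda>y. h (x(u := y))) \<in> borel_measurable (M u)"
    if "h \<in> borel_measurable (PiM (insert u I) M)" "x \<in> space (PiM I M)" for h :: "('i \<Rightarrow> 'a) \<Rightarrow> real" and x
    using measurable_Pair2[OF meas2[OF that(1)] that(2)] by simp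
  have meas: "(\<lambda>x. \<integral>y. h (x(u := y)) \<partial>M u) \<in> borel_measurable (PiM I M)"
    if "h \<in> borel_measurable (PiM (insert u I) M)" for h :: "('i \<Rightarrow> 'a) \<Rightarrow> real"
    using meas2[OF that] by measurable
  have split: "(\<integral>x. h x \<partial>PiM (insert u I) M) = (\<integral>x. (\<integral>y. h (x(u := y)) \<partial>M u) \<partial>PiM I M)"
    if "h \<in> borel_measurable (PiM (insert u I) M)" "\<And>x. x \<in> space (PiM (insert u I) M) \<Longrightarrow> \<bar>h x\<bar> \<le> b"
    for h :: "('i \<Rightarrow> 'a) \<Rightarrow> real" and b
    using insert.hyps that
    by (intro product_integral_insert PuI.integrable_const_bound[of _ b]) auto
  have fibre: "integrable (M u) (\<lambda>y. h (x(u := y)))"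
    if "h \<in> borel_measurable (PiM (insert u I) M)" "\<And>x. x \<in> space (PiM (insert u I) M) \<Longrightarrow> \<bar>h x\<bar> \<le> b"
      "x \<in> space (PiM I M)" for h :: "('i \<Rightarrow> 'a) \<Rightarrow> real" and b x
    using that upd by (intro Mu.integrable_const_bound[of _ b] meas1) auto
  have avg_bound: "\<bar>\<integral>y. h (x(u := y)) \<partial>M u\<bar> \<le> b"
    if "h \<in> borel_measurable (PiM (insert u I) M)" "\<And>x. x \<in> space (PiM (insert u I) M) \<Longrightarrow> \<bar>h x\<bar> \<le> b"
      "x \<in> space (PiM I M)" for h :: "('i \<Rightarrow> 'a) \<Rightarrow> real" and b x
  proof -
    note i = fibre[OF that]
    have b: "h (x(u := y)) \<le> b" "-b \<le> h (x(u := y))" if "y \<in> space (M u)" for y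
      using \<open>\<And>x. x \<in> space (PiM (insert u I) M) \<Longrightarrow> \<bar>h x\<bar> \<le> b\<close>[OF upd, OF \<open>x \<in> space (PiM I M)\<close> that] by linarith+
    have "(\<integral>y. h (x(u := y)) \<partial>M u) \<le> b"
      by (intro Mu.integral_le_const i AE_I2 b)
    moreover have "-b \<le> (\<integral>y. h (x(u := y)) \<partial>M u)"
      by (intro Mu.integral_ge_const i AE_I2 b)
    ultimately show ?thesis by auto
  qed
  have sq_bound: "\<bar>t\<^sup>2\<bar> \<le> b\<^sup>2" if "\<bar>t\<bar> \<le> b" for t b :: real
    using that by (simp add: abs_le_square_iff[symmetric])
  have gb: "\<bar>f x - g w x\<bar> \<le> 2 * B" if "w \<in> insert u I" "x \<in> space (PiM (insert u I) M)" for w x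
    using insert.prems(2)[OF that(2)] insert.prems(4)[OF that] by linarith
  have fm[measurable]: "f \<in> borel_measurable (PiM (insert u I) M)" by fact
  have gm: "g w \<in> borel_measurable (PiM (insert u I) M)" if "w \<in> insert u I" for w
    using insert.prems(3) that by blast
  \<comment> \<open>Integrating out coordinate \<open>u\<close> turns \<open>f\<close> and every
    \<open>g w\<close> into functions of the remaining coordinates, to which the induction
    hypothesis applies.\<close>
  define F where "F x = (\<integral>y. f (x(u := y)) \<partial>M u)" for x
  define G where "G w x = (\<integral>y. g w (x(u := y)) \<partial>M u)" for w x
  have IH: "(\<integral>x. (F x)\<^sup>2 \<partial>PiM I M) - (\<integral>x. F x \<partial>PiM I M)\<^sup>2 \<le> (\<Sum>w\<in>I. \<integral>x. (F x - G w x)\<^sup>2 \<partial>PiM I M)"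
  proof (rule insert.IH)
    show "F \<in> borel_measurable (PiM I M)" unfolding F_def by (rule meas) fact
    show "\<bar>F x\<bar> \<le> B" if "x \<in> space (PiM I M)" for x
      unfolding F_def using that insert.prems(2) by (intro avg_bound) auto
    show "G w \<in> borel_measurable (PiM I M)" if "w \<in> I" for w
      unfolding G_def using that by (intro meas gm) auto
    show "\<bar>G w x\<bar> \<le> B" if "w \<in> I" "x \<in> space (PiM I M)" for w x
      unfolding G_def using that insert.prems(4) by (intro avg_bound gm) auto
    show "G w (x(w := z)) = G w x" if "w \<in> I" "x \<in> space (PiM I M)" "z \<in> space (M w)" for w x z
    proof -
      have "w \<noteq> u" using that insert.hyps by auto
      then have "g w (x(w := z, u := y)) = g w (x(u := y))" if "y \<in> space (M u)" for y
        unfolding fun_upd_twist[OF \<open>w \<noteq> u\<close>]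
        by (intro insert.prems(5) upd that insertI2 \<open>w \<in> I\<close> \<open>z \<in> space (M w)\<close> \<open>x \<in> space (PiM I M)\<close>)
      then show ?thesis unfolding G_def by (intro Bochner_Integration.integral_cong) auto
    qed
  qed
  \<comment> \<open>Jensen on each fibre: the summands for the old coordinates can only grow when
    \<open>u\<close> is restored.\<close>
  have le: "(\<integral>x. (F x - G w x)\<^sup>2 \<partial>PiM I M) \<le> (\<integral>x. (f x - g w x)\<^sup>2 \<partial>PiM (insert u I) M)" if w: "w \<in> I" for w
  proof -
    note gmw [measurable] = gm[of w]
    have w': "w \<in> insert u I" using w by simp
    have d[measurable]: "(\<lambda>x. f x - g w x) \<in> borel_measurable (PiM (insert u I) M)"
      using gm[OF w'] by measurable
    have pt: "(F x - G w x)\<^sup>2 \<le> (\<integral>y. (f (x(u := y)) - g w (x(u := y)))\<^sup>2 \<partial>M u)" if x: "x \<in> space (PiM I M)" for x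
    proof -
      have "integrable (M u) (\<lambda>y. f (x(u := y)))" "integrable (M u) (\<lambda>y. g w (x(u := y)))"
        using insert.prems(2,4) w' by (auto intro!: fibre[of _ B] gm x)
      then have "F x - G w x = (\<integral>y. f (x(u := y)) - g w (x(u := y)) \<partial>M u)"
        unfolding F_def G_def by simp
      moreover have "(\<integral>y. f (x(u := y)) - g w (x(u := y)) \<partial>M u)\<^sup>2 \<le> (\<integral>y. (f (x(u := y)) - g w (x(u := y)))\<^sup>2 \<partial>M u)"
        using gb[OF w'] upd[OF x] meas1[OF d x] by (intro Mu.square_integral_le[of _ "2 * B"]) auto
      ultimately show ?thesis by simp
    qed
    have d2: "(\<lambda>x. (f x - g w x)\<^sup>2) \<in> borel_measurable (PiM (insert u I) M)" by measurable
    have b2: "\<bar>(f x - g w x)\<^sup>2\<bar> \<le> (2 * B)\<^sup>2" if "x \<in> space (PiM (insert u I) M)" for x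
      using gb[OF w' that] by (rule sq_bound)
    have Fm: "F \<in> borel_measurable (PiM I M)" "G w \<in> borel_measurable (PiM I M)"
      unfolding F_def G_def using w' by (auto intro: meas gm)
    have "\<bar>(F x - G w x)\<^sup>2\<bar> \<le> (2 * B)\<^sup>2" if "x \<in> space (PiM I M)" for x
    proof -
      have "\<bar>F x\<bar> \<le> B" "\<bar>G w x\<bar> \<le> B"
        unfolding F_def G_def using that insert.prems(2,4) w' by (auto intro!: avg_bound gm)
      then show ?thesis by (intro sq_bound) linarith
    qed
    then have i1: "integrable (PiM I M) (\<lambda>x. (F x - G w x)\<^sup>2)"
      using Fm by (intro PI.integrable_const_bound[of _ "(2*B)\<^sup>2"]) auto
    have i2: "integrable (PiM I M) (\<lambda>x. \<integral>y. (f (x(u := y)) - g w (x(u := y)))\<^sup>2 \<partial>M u)"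
      using avg_bound[OF d2 b2] by (intro PI.integrable_const_bound[of _ "(2*B)\<^sup>2"] meas[OF d2]) auto
    have "(\<integral>x. (F x - G w x)\<^sup>2 \<partial>PiM I M) \<le> (\<integral>x. (\<integral>y. (f (x(u := y)) - g w (x(u := y)))\<^sup>2 \<partial>M u) \<partial>PiM I M)"
      by (intro integral_mono_AE AE_I2 pt i1 i2)
    also have "\<dots> = (\<integral>x. (f x - g w x)\<^sup>2 \<partial>PiM (insert u I) M)"
      using split[OF d2 b2] by simp
    finally show ?thesis .
  qed
  have f2: "(\<lambda>x. (f x)\<^sup>2) \<in> borel_measurable (PiM (insert u I) M)" by measurable
  have f2b: "\<bar>(f x)\<^sup>2\<bar> \<le> B\<^sup>2" if "x \<in> space (PiM (insert u I) M)" for x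
    using insert.prems(2)[OF that] by (rule sq_bound)
  have gu: "(\<lambda>x. (f x - g u x)\<^sup>2) \<in> borel_measurable (PiM (insert u I) M)"
    using gm[of u] by measurable
  have gub: "\<bar>(f x - g u x)\<^sup>2\<bar> \<le> (2 * B)\<^sup>2" if "x \<in> space (PiM (insert u I) M)" for x
    using gb[OF _ that] by (intro sq_bound) auto
  \<comment> \<open>Along a fibre \<open>g u\<close> is a constant \<open>c\<close>, and the mean
    \<open>F x\<close> is the constant with the least mean squared distance from
    \<open>f\<close>.\<close>
  have pt: "(\<integral>y. (f (x(u := y)))\<^sup>2 \<partial>M u) - (F x)\<^sup>2 \<le> (\<integral>y. (f (x(u := y)) - g u (x(u := y)))\<^sup>2 \<partial>M u)"
    if x: "x \<in> space (PiM I M)" for x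
  proof -
    obtain y0 where y0: "y0 \<in> space (M u)" using Mu.not_empty by auto
    define c where "c = g u (x(u := y0))"
    have c: "g u (x(u := y)) = c" if "y \<in> space (M u)" for y
    proof -
      have "g u (x(u := y0, u := y)) = g u (x(u := y0))"
        by (intro insert.prems(5) upd x y0 that insertI1)
      then show ?thesis by (simp add: c_def)
    qed
    have i1: "integrable (M u) (\<lambda>y. f (x(u := y)))"
      using insert.prems(2) by (auto intro!: fibre[of _ B] fm x)
    have i2: "integrable (M u) (\<lambda>y. (f (x(u := y)))\<^sup>2)"
      by (rule fibre[OF f2 f2b x])
    have "(\<integral>y. (f (x(u := y)) - g u (x(u := y)))\<^sup>2 \<partial>M u) = (\<integral>y. (f (x(u := y)))\<^sup>2 - 2 * c * f (x(u := y)) + c\<^sup>2 \<partial>M u)"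
      by (intro Bochner_Integration.integral_cong) (auto simp: c power2_eq_square algebra_simps)
    also have "\<dots> = (\<integral>y. (f (x(u := y)))\<^sup>2 \<partial>M u) - 2 * c * F x + c\<^sup>2"
      using i1 i2 by (simp add: F_def Mu.prob_space)
    also have "\<dots> = (\<integral>y. (f (x(u := y)))\<^sup>2 \<partial>M u) - (F x)\<^sup>2 + (F x - c)\<^sup>2"
      by (simp add: power2_eq_square algebra_simps)
    finally show ?thesis by simp
  qed
  have Fm: "F \<in> borel_measurable (PiM I M)" unfolding F_def by (rule meas[OF fm])
  have Fb: "\<bar>F x\<bar> \<le> B" if "x \<in> space (PiM I M)" for x
    unfolding F_def using that insert.prems(2) by (intro avg_bound) auto
  have iF2: "integrable (PiM I M) (\<lambda>x. (F x)\<^sup>2)"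
    using Fm sq_bound[OF Fb] by (intro PI.integrable_const_bound[of _ "B\<^sup>2"]) auto
  have if2: "integrable (PiM I M) (\<lambda>x. \<integral>y. (f (x(u := y)))\<^sup>2 \<partial>M u)"
    using avg_bound[OF f2 f2b] by (intro PI.integrable_const_bound[of _ "B\<^sup>2"] meas[OF f2]) auto
  have igu: "integrable (PiM I M) (\<lambda>x. \<integral>y. (f (x(u := y)) - g u (x(u := y)))\<^sup>2 \<partial>M u)"
    using avg_bound[OF gu gub] by (intro PI.integrable_const_bound[of _ "(2*B)\<^sup>2"] meas[OF gu]) auto
  \<comment> \<open>The difference is the mean fibre variance in the law of total variance.\<close>
  have "(\<integral>x. (f x)\<^sup>2 \<partial>PiM (insert u I) M) - (\<integral>x. (F x)\<^sup>2 \<partial>PiM I M)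
      = (\<integral>x. (\<integral>y. (f (x(u := y)))\<^sup>2 \<partial>M u) - (F x)\<^sup>2 \<partial>PiM I M)"
    using split[OF f2 f2b] iF2 if2 by simp
  also have "\<dots> \<le> (\<integral>x. (\<integral>y. (f (x(u := y)) - g u (x(u := y)))\<^sup>2 \<partial>M u) \<partial>PiM I M)"
    by (intro integral_mono_AE AE_I2 pt Bochner_Integration.integrable_diff if2 iF2 igu)
  also have "\<dots> = (\<integral>x. (f x - g u x)\<^sup>2 \<partial>PiM (insert u I) M)"
    using split[OF gu gub] by simp
  finally have *: "(\<integral>x. (f x)\<^sup>2 \<partial>PiM (insert u I) M) - (\<integral>x. (F x)\<^sup>2 \<partial>PiM I M) \<le> (\<integral>x. (f x - g u x)\<^sup>2 \<partial>PiM (insert u I) M)" .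
  have "(\<integral>x. f x \<partial>PiM (insert u I) M) = (\<integral>x. F x \<partial>PiM I M)"
    unfolding F_def by (rule split[OF fm insert.prems(2)])
  moreover have "(\<Sum>w\<in>I. \<integral>x. (F x - G w x)\<^sup>2 \<partial>PiM I M) \<le> (\<Sum>w\<in>I. \<integral>x. (f x - g w x)\<^sup>2 \<partial>PiM (insert u I) M)"
    by (intro sum_mono le)
  ultimately show ?case using IH * insert.hyps by simp
qed

section \<open>Nearest neighbour trees\<close>

text \<open>\<open>S\<close> is a set of deleted vertices, and \<open>of_bool (0 < v)\<close> counts the edge of \<open>v\<close> to its parent.\<close>

definition nearest_in :: "('a \<Rightarrow> 'a \<Rightarrow> real) \<Rightarrow> nat set \<Rightarrow> (nat \<Rightarrow> 'a) \<Rightarrow> nat \<Rightarrow> nat" where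
  "nearest_in D J X w = (LEAST u. u \<in> J \<and> (\<forall>x\<in>J. D (X w) (X u) \<le> D (X w) (X x)))"

definition children :: "('a \<Rightarrow> 'a \<Rightarrow> real) \<Rightarrow> nat set \<Rightarrow> nat \<Rightarrow> (nat \<Rightarrow> 'a) \<Rightarrow> nat \<Rightarrow> nat set" where
  "children D S n X v = {w. v < w \<and> w < n \<and> w \<notin> S \<and> nearest_in D ({..<w} - S) X w = v}"

definition high_degree :: "('a \<Rightarrow> 'a \<Rightarrow> real) \<Rightarrow> nat set \<Rightarrow> nat \<Rightarrow> nat \<Rightarrow> (nat \<Rightarrow> 'a) \<Rightarrow> nat set" where
  "high_degree D S n i X = {v. v < n \<and> v \<notin> S \<and> i \<le> card (children D S n X v) + of_bool (0 < v)}"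

lemma finite_children [simp]: "finite (children D S n X v)"
  by (rule finite_subset[of _ "{..<n}"]) (auto simp: children_def)

lemma finite_high_degree [simp]: "finite (high_degree D S n i X)"
  unfolding high_degree_def by (rule finite_subset[of _ "{..<n}"]) blast+

lemma card_children_le: "card (children D S n X v) \<le> n"
proof -
  have "children D S n X v \<subseteq> {..<n}" by (auto simp: children_def)
  from card_mono[OF _ this] show ?thesis by simp
qed

lemma card_high_degree_le: "card (high_degree D S n i X) \<le> n"
proof -
  have "high_degree D S n i X \<subseteq> {..<n}" by (auto simp: high_degree_def)
  from card_mono[OF _ this] show ?thesis by simp
qed

lemma nearest_in_minimizes:
  assumes "finite J" "J \<noteq> {}"
  shows "nearest_in D J X w \<in> J \<and> (\<forall>x\<in>J. D (X w) (X (nearest_in D J X w)) \<le> D (X w) (X x))"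
proof -
  obtain u where "u \<in> J" "\<forall>x\<in>J. D (X w) (X u) \<le> D (X w) (X x)"
    using arg_min_if_finite[OF assms, of "\<lambda>x. D (X w) (X x)"] by (auto simp: not_less)
  then show ?thesis
    unfolding nearest_in_def by (intro LeastI[of "\<lambda>u. u \<in> J \<and> (\<forall>x\<in>J. D (X w) (X u) \<le> D (X w) (X x))" u] conjI)
qed

text \<open>A minimiser over the smaller set is as close as the old minimiser, hence also minimises
  over \<open>J\<close>; so even the tie-breaking by least index survives the deletion.\<close>

lemma nearest_in_remove:
  assumes "finite J" "J \<noteq> {}" and ne: "nearest_in D J X w \<noteq> u"
  shows "nearest_in D (J - {u}) X w = nearest_in D J X w"
proof -
  let ?p = "nearest_in D J X w"
  note p = nearest_in_minimizes[OF assms(1,2), of D X w]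
  have least: "?p \<le> y" if "y \<in> J" "\<forall>x\<in>J. D (X w) (X y) \<le> D (X w) (X x)" for y
    unfolding nearest_in_def using that by (intro Least_le) auto
  show ?thesis
    unfolding nearest_in_def[of D "J - {u}"]
  proof (rule Least_equality)
    show "?p \<in> J - {u} \<and> (\<forall>x\<in>J - {u}. D (X w) (X ?p) \<le> D (X w) (X x))"
      using p ne by auto
    fix y assume y: "y \<in> J - {u} \<and> (\<forall>x\<in>J - {u}. D (X w) (X y) \<le> D (X w) (X x))"
    then have "D (X w) (X y) \<le> D (X w) (X ?p)" using p ne by auto
    then show "?p \<le> y" using p y by (intro least) (auto intro: order.trans)
  qed
qed

lemma nearest_in_less: "0 < w \<Longrightarrow> nearest_in D {..<w} X w < w"
  using nearest_in_minimizes[of "{..<w}" D X w] by auto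

text \<open>Each vertex after the root has exactly one parent, so the sets of children are
  disjoint.\<close>

lemma sum_card_children:
  "(\<Sum>v<m. card (children D {} n X v)) = card {w \<in> {1..<n}. nearest_in D {..<w} X w < m}"
proof -
  have "(\<Sum>v<m. card (children D {} n X v)) = card (\<Union>v<m. children D {} n X v)"
    by (intro card_UN_disjoint[symmetric]) (auto simp: children_def)
  also have "(\<Union>v<m. children D {} n X v) = {w \<in> {1..<n}. nearest_in D {..<w} X w < m}"
    by (auto simp: children_def Suc_le_eq intro: nearest_in_less)
  finally show ?thesis .
qed

lemma card_high_degree_eq_sum:
  "card (high_degree D S n i X) = (\<Sum>v\<in>{..<n} - S. of_bool (i \<le> card (children D S n X v) + of_bool (0 < v)))"
proof -
  have "high_degree D S n i X = ({..<n} - S) \<inter> {v. i \<le> card (children D S n X v) + of_bool (0 < v)}"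
    by (auto simp: high_degree_def)
  then show ?thesis by (simp add: sum_of_bool_eq)
qed

text \<open>Degree at least 2 forces one child and degree at least 3 forces two, so each vertex
  contributes at most its number of children. This keeps the count at 2 away from \<open>n\<close>
  as soon as the count at 3 is linear in \<open>n\<close>.\<close>

lemma card_high_degree_2_3: "card (high_degree D {} n 2 X) + card (high_degree D {} n 3 X) \<le> n"
proof -
  have "of_bool (2 \<le> c + b) + of_bool (3 \<le> c + b) \<le> c" if "b \<le> 1" for b c :: nat
    using that by (cases "3 \<le> c + b"; cases "2 \<le> c + b") auto
  from this[OF of_bool_less_eq_one]
  have "card (high_degree D {} n 2 X) + card (high_degree D {} n 3 X) \<le> (\<Sum>v<n. card (children D {} n X v))"
    unfolding card_high_degree_eq_sum sum.distrib[symmetric] Diff_empty by (rule sum_mono)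
  also have "\<dots> \<le> card {1..<n}"
    unfolding sum_card_children by (intro card_mono) auto
  finally show ?thesis by simp
qed

lemma high_degree_antimono: "i \<le> j \<Longrightarrow> high_degree D S n j X \<subseteq> high_degree D S n i X"
  unfolding high_degree_def by (blast intro: order_trans)

section \<open>Stability of the degree counts under deletion of a vertex\<close>

lemma card_diff_le_of_agree_outside:
  assumes "finite A" "finite B" "finite T" "A - T = B - T"
  shows "\<bar>real (card A) - real (card B)\<bar> \<le> real (card T)"
proof -
  have "card A \<le> card (B \<union> T)" "card B \<le> card (A \<union> T)"
    using assms by (auto intro!: card_mono)
  then show ?thesis
    using card_Un_le[of A T] card_Un_le[of B T] by linarith
qed

text \<open>Only the former children of \<open>u\<close> change parent, so only \<open>u\<close>,
  its parent and the new parents of those children can gain or lose a child.\<close>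

lemma high_degree_remove_vertex:
  assumes "u < n"
  shows "\<bar>real (card (high_degree D {} n i X)) - real (card (high_degree D {u} n i X))\<bar>
    \<le> 2 + real (card (children D {} n X u))"
proof -
  define p where "p w = nearest_in D {..<w} X w" for w
  define q where "q w = nearest_in D ({..<w} - {u}) X w" for w
  \<comment> \<open>For \<open>u = 0\<close> the value \<open>p u\<close> is arbitrary and merely
    enlarges \<open>T\<close>.\<close>
  define T where "T = {u, p u} \<union> q ` children D {} n X u"
  have qp: "q w = p w" if "0 < w" "p w \<noteq> u" for w
    unfolding q_def p_def using that by (intro nearest_in_remove) (auto simp: p_def)
  have pl: "p w < w" if "0 < w" for w
    using that nearest_in_less by (auto simp: p_def)
  have chu: "w \<in> children D {} n X u" if "p w = u" "0 < w" "w < n" for w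
    using that pl[of w] by (auto simp: children_def p_def)
  have same: "children D {} n X v = children D {u} n X v" if "v \<notin> T" for v
  proof (intro set_eqI iffI)
    fix w assume "w \<in> children D {} n X v"
    then have w: "v < w" "w < n" "p w = v" by (auto simp: children_def p_def)
    then have "w \<noteq> u" "p w \<noteq> u" using that by (auto simp: T_def)
    then show "w \<in> children D {u} n X v"
      using w qp[of w] by (auto simp: children_def q_def)
  next
    fix w assume "w \<in> children D {u} n X v"
    then have w: "v < w" "w < n" "q w = v" by (auto simp: children_def q_def)
    then have "p w \<noteq> u" using that chu[of w] by (auto simp: T_def)
    then show "w \<in> children D {} n X v"
      using w qp[of w] by (auto simp: children_def p_def)
  qed
  have "card T \<le> card {u, p u} + card (q ` children D {} n X u)"
    unfolding T_def by (rule card_Un_le)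
  moreover have "card {u, p u} \<le> 2"
    by (simp add: card_insert_if)
  moreover have "card (q ` children D {} n X u) \<le> card (children D {} n X u)"
    by (intro card_image_le) simp
  ultimately have "real (card T) \<le> 2 + real (card (children D {} n X u))" by linarith
  moreover have "v \<in> high_degree D {} n i X \<longleftrightarrow> v \<in> high_degree D {u} n i X" if "v \<notin> T" for v
  proof -
    have "v \<noteq> u" using that by (simp add: T_def)
    then show ?thesis by (simp only: high_degree_def mem_Collect_eq same[OF that]) simp
  qed
  then have "high_degree D {} n i X - T = high_degree D {u} n i X - T" by blast
  then have "\<bar>real (card (high_degree D {} n i X)) - real (card (high_degree D {u} n i X))\<bar> \<le> real (card T)"
    by (intro card_diff_le_of_agree_outside) (auto simp: T_def)
  ultimately show ?thesis by linarith
qed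

lemma nearest_in_cong:
  assumes "\<And>x. x \<in> insert w J \<Longrightarrow> X x = Y x"
  shows "nearest_in D J X w = nearest_in D J Y w"
  unfolding nearest_in_def
proof (intro arg_cong[where f=Least] ext conj_cong refl ball_cong)
  fix u x assume "u \<in> J" "x \<in> J"
  then show "(D (X w) (X u) \<le> D (X w) (X x)) = (D (Y w) (Y u) \<le> D (Y w) (Y x))"
    using assms[of w] assms[of u] assms[of x] by simp
qed

text \<open>The deleted vertex is neither an arrival nor a candidate parent, so its position is
  never read; this is the blindness required by \<open>efron_stein\<close>.\<close>

lemma high_degree_removed_upd: "high_degree D {u} n i (X(u := y)) = high_degree D {u} n i X"
proof -
  have "nearest_in D ({..<w} - {u}) (X(u := y)) w = nearest_in D ({..<w} - {u}) X w" if "w \<noteq> u" for w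
    using that by (intro nearest_in_cong) auto
  then have "children D {u} n (X(u := y)) v = children D {u} n X v" for v
    by (auto simp: children_def)
  then show ?thesis by (simp add: high_degree_def)
qed

section \<open>Independent points\<close>

text \<open>Geometry enters only through \<open>kissing\<close>, a bound on how many points can have
  the same point \<open>y\<close> as nearest neighbour. Points carry labels so that coincident ones
  count separately, and positivity excludes those at distance zero from \<open>y\<close>.\<close>

locale nn_points = prob_space M for M :: "'a measure" +
  fixes D :: "'a \<Rightarrow> 'a \<Rightarrow> real" and \<kappa> :: nat
  assumes D_measurable [measurable]: "case_prod D \<in> borel_measurable (M \<Otimes>\<^sub>M M)"
    and D_pos: "AE y in M. AE x in M. 0 < D x y"
    and kissing: "\<And>(U :: nat set) X y. finite U \<Longrightarrow> (\<And>u. u \<in> U \<Longrightarrow> 0 < D (X u) y) \<Longrightarrow>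
      (\<And>u u'. u \<in> U \<Longrightarrow> u' \<in> U \<Longrightarrow> u \<noteq> u' \<Longrightarrow> D (X u) y \<le> D (X u) (X u')) \<Longrightarrow> card U \<le> \<kappa>"
    and \<kappa>_pos: "0 < \<kappa>"
begin

abbreviation points :: "nat \<Rightarrow> (nat \<Rightarrow> 'a) measure" where
  "points n \<equiv> PiM {..<n} (\<lambda>_. M)"

lemma prob_space_points: "prob_space (points n)"
  by (intro prob_space_PiM prob_space_axioms)

lemma D_points_measurable [measurable]:
  assumes "u < n" "v < n"
  shows "(\<lambda>X. D (X u) (X v)) \<in> borel_measurable (points n)"
proof -
  have "(\<lambda>X. (X u, X v)) \<in> measurable (points n) (M \<Otimes>\<^sub>M M)"
    using assms by (intro measurable_Pair measurable_component_singleton) auto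
  from measurable_compose[OF this D_measurable] show ?thesis by simp
qed

lemma D_le_measurable:
  assumes "w < n" "u < n" "x < n"
  shows "Measurable.pred (points n) (\<lambda>X. D (X w) (X u) \<le> D (X w) (X x))"
  unfolding pred_def by (intro borel_measurable_le D_points_measurable assms)

lemma nearest_in_measurable:
  assumes "J \<subseteq> {..<n}" "w < n"
  shows "(\<lambda>X. nearest_in D J X w) \<in> measurable (points n) (count_space UNIV)"
  unfolding nearest_in_def
proof (rule measurable_Least)
  fix u
  have J: "finite J" using assms finite_subset by blast
  show "Measurable.pred (points n) (\<lambda>X. u \<in> J \<and> (\<forall>x\<in>J. D (X w) (X u) \<le> D (X w) (X x)))"
  proof (cases "u \<in> J")
    case True
    have "Measurable.pred (points n) (\<lambda>X. D (X w) (X u) \<le> D (X w) (X x))" if "x \<in> J" for x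
      using that True assms by (intro D_le_measurable) auto
    then show ?thesis using J True by (auto intro!: pred_intros_finite)
  qed auto
qed

lemma card_children_measurable:
  "(\<lambda>X. real (card (children D S n X v))) \<in> borel_measurable (points n)"
proof -
  have "children D S n X v = ({v<..<n} - S) \<inter> {w. nearest_in D ({..<w} - S) X w = v}" for X
    by (auto simp: children_def)
  then have eq: "real (card (children D S n X v)) = (\<Sum>w\<in>{v<..<n} - S. of_bool (nearest_in D ({..<w} - S) X w = v))" for X
    by (simp add: sum_of_bool_eq)
  have "Measurable.pred (points n) (\<lambda>X. nearest_in D ({..<w} - S) X w = v)" if "w < n" for w
    proof -
    have "{..<w} - S \<subseteq> {..<n}" using that by auto
    from measurable_compose[OF nearest_in_measurable[OF this that], of "\<lambda>x. x = v" "count_space UNIV"]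
    show ?thesis by simp
  qed
  then show ?thesis
    unfolding eq by (intro borel_measurable_sum) auto
qed

lemma card_high_degree_measurable [measurable]:
  "(\<lambda>X. real (card (high_degree D S n i X))) \<in> borel_measurable (points n)"
proof -
  have pred: "Measurable.pred (points n) (\<lambda>X. i \<le> card (children D S n X v) + of_bool (0 < v))" for v
  proof -
    have eq: "i \<le> card (children D S n X v) + of_bool (0 < v) \<longleftrightarrow> real i \<le> real (card (children D S n X v)) + of_bool (0 < v)" for X
      by (cases "0 < v") auto
    note [measurable] = card_children_measurable
    show ?thesis unfolding eq by measurable
  qed
  have eq: "real (card (high_degree D S n i X)) = (\<Sum>v\<in>{..<n} - S. of_bool (i \<le> card (children D S n X v) + of_bool (0 < v)))" for X
    by (simp only: card_high_degree_eq_sum of_nat_sum of_nat_of_bool)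
  show ?thesis
    unfolding eq of_bool_def by (intro borel_measurable_sum measurable_If predE[OF pred, unfolded of_bool_def] borel_measurable_const)
qed

text \<open>Fubini with coordinate \<open>u\<close> innermost: for almost every choice of the other
  points, almost every position of \<open>u\<close> is at positive distance from that of
  \<open>v\<close>.\<close>

lemma AE_D_pos:
  assumes "u < n" "v < n" "u \<noteq> v"
  shows "AE X in points n. 0 < D (X u) (X v)"
proof -
  interpret product_sigma_finite "\<lambda>_::nat. M"
    by (simp add: product_sigma_finite_def sigma_finite_measure_axioms)
  let ?I = "{..<n} - {u}"
  have I: "insert u ?I = {..<n}" using assms by auto
  have AEv: "AE X in PiM ?I (\<lambda>_. M). AE x in M. 0 < D x (X v)"
    by (rule AE_PiM_component[OF prob_space_axioms _ D_pos]) (use assms in auto)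
  let ?B = "{X \<in> space (points n). \<not> 0 < D (X u) (X v)}"
  have B: "?B \<in> sets (points n)" using assms by measurable
  have "emeasure (points n) ?B = (\<integral>\<^sup>+ X. indicator ?B X \<partial>PiM (insert u ?I) (\<lambda>_. M))"
    using B by (simp only: I nn_integral_indicator)
  also have "\<dots> = (\<integral>\<^sup>+ X. (\<integral>\<^sup>+ y. indicator ?B (X(u := y)) \<partial>M) \<partial>PiM ?I (\<lambda>_. M))"
    by (intro product_nn_integral_insert) (use B in \<open>simp_all add: I del: insert_Diff_single\<close>)
  also have "\<dots> = (\<integral>\<^sup>+ X. 0 \<partial>PiM ?I (\<lambda>_. M))"
  proof (rule nn_integral_cong_AE, use AEv in eventually_elim)
    fix X assume "AE x in M. 0 < D x (X v)"
    then have "AE y in M. indicator ?B (X(u := y)) = (0::ennreal)"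
      by eventually_elim (use assms in \<open>auto simp: indicator_def\<close>)
    then show "(\<integral>\<^sup>+ y. indicator ?B (X(u := y)) \<partial>M) = 0"
      by (subst nn_integral_cong_AE) auto
  qed
  finally have "?B \<in> null_sets (points n)" using B by (simp add: null_sets_def)
  then show ?thesis by (rule AE_I') auto
qed

text \<open>Exchangeability: a product of equal factors is invariant under permuting coordinates.
  Outside \<open>{..<n}\<close> the transposition moves nothing, so plain composition stays in the
  product space.\<close>

lemma comp_transpose_measurable:
  assumes "i < n" "j < n"
  shows "(\<lambda>X. X \<circ> Transposition.transpose i j) \<in> measurable (points n) (points n)"
    and "distr (points n) (points n) (\<lambda>X. X \<circ> Transposition.transpose i j) = points n"
proof -
  let ?t = "Transposition.transpose i j"
  let ?T = "\<lambda>X. \<lambda>k\<in>{..<n}. X (?t k)"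
  have t: "?t \<in> {..<n} \<rightarrow> {..<n}" "inj_on ?t {..<n}"
    using assms by (auto simp: Transposition.transpose_def inj_on_def split: if_splits)
  have d: "distr (points n) (points n) ?T = points n"
    using distr_PiM_reindex[of "{..<n}" "\<lambda>_. M" ?t "{..<n}"] t prob_space_axioms by simp
  have m: "?T \<in> measurable (points n) (points n)"
    using t by (intro measurable_restrict measurable_component_singleton) auto
  have eq: "X \<circ> ?t = ?T X" if "X \<in> space (points n)" for X
    using that assms by (auto simp: space_PiM PiE_def extensional_def Transposition.transpose_def restrict_def)
  show "(\<lambda>X. X \<circ> ?t) \<in> measurable (points n) (points n)"
    by (rule measurable_cong[THEN iffD2, OF _ m]) (rule eq)
  have "distr (points n) (points n) (\<lambda>X. X \<circ> ?t) = distr (points n) (points n) ?T"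
    by (intro distr_cong refl eq)
  then show "distr (points n) (points n) (\<lambda>X. X \<circ> ?t) = points n"
    unfolding d .
qed

lemma integral_swap:
  fixes F :: "(nat \<Rightarrow> 'a) \<Rightarrow> real"
  assumes "i < n" "j < n" and "F \<in> borel_measurable (points n)"
  shows "(\<integral>X. F (X \<circ> Transposition.transpose i j) \<partial>points n) = (\<integral>X. F X \<partial>points n)"
  using integral_distr[OF comp_transpose_measurable(1)[OF assms(1,2)] assms(3)]
  unfolding comp_transpose_measurable(2)[OF assms(1,2)] by (rule sym)

section \<open>Revealing the arrival order backwards\<close>

text \<open>A relaxation of \<open>w\<close> choosing \<open>v\<close> as parent: without a tie rule
  the condition is symmetric in the labels of the other earlier points, as the exchange arguments
  require.\<close>

definition serves :: "(nat \<Rightarrow> 'a) \<Rightarrow> nat \<Rightarrow> nat \<Rightarrow> bool" where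
  "serves X v w \<longleftrightarrow> (\<forall>x<w. D (X w) (X v) \<le> D (X w) (X x))"

lemma serves_measurable [measurable]:
  assumes "v < n" "w < n"
  shows "Measurable.pred (points n) (\<lambda>X. serves X v w)"
proof -
  have "Measurable.pred (points n) (\<lambda>X. \<forall>x\<in>{..<w}. D (X w) (X v) \<le> D (X w) (X x))"
    using assms by (intro pred_intros_finite D_le_measurable) auto
  then show ?thesis unfolding serves_def Ball_def lessThan_iff .
qed

lemma children_serves:
  assumes "w \<in> children D {} n X v"
  shows "serves X v w"
proof -
  have w: "v < w" "nearest_in D {..<w} X w = v" using assms by (simp_all add: children_def)
  then have "{..<w} \<noteq> {}" by auto
  from nearest_in_minimizes[OF finite_lessThan this, of D X w] show ?thesis
    unfolding w(2) by (simp add: serves_def)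
qed

text \<open>A power of 1 + a whose exponent counts the arrivals from \<open>k\<close> on that
  \<open>v\<close> serves. Moving the starting point \<open>k\<close> reveals the arrivals one at a
  time.\<close>

definition branching :: "real \<Rightarrow> nat \<Rightarrow> nat \<Rightarrow> nat \<Rightarrow> (nat \<Rightarrow> 'a) \<Rightarrow> real" where
  "branching a v k n X = (\<Prod>w\<in>{k..<n}. 1 + a * of_bool (serves X v w))"

lemma branching_measurable [measurable]:
  assumes "v < k"
  shows "branching a v k n \<in> borel_measurable (points n)"
proof -
  have "(\<lambda>X. 1 + a * of_bool (serves X v w)) \<in> borel_measurable (points n)" if "w \<in> {k..<n}" for w
    using that assms serves_measurable[of v n w] by auto
  then show ?thesis
    unfolding branching_def[abs_def] by (intro borel_measurable_prod) auto
qed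

lemma branching_bounds:
  assumes "0 \<le> a"
  shows "1 \<le> branching a v k n X" "branching a v k n X \<le> (1 + a) ^ n"
proof -
  show "1 \<le> branching a v k n X"
    unfolding branching_def using assms by (intro prod_ge_1) auto
  have "branching a v k n X \<le> (\<Prod>w\<in>{k..<n}. 1 + a)"
    unfolding branching_def using assms by (intro prod_mono) auto
  also have "\<dots> \<le> (1 + a) ^ n"
    using assms by (auto intro!: power_increasing)
  finally show "branching a v k n X \<le> (1 + a) ^ n" .
qed

lemma branching_integrable:
  assumes "0 \<le> a" "v < k"
  shows "integrable (points n) (branching a v k n)"
proof -
  interpret P: prob_space "points n" by (rule prob_space_points)
  have "norm (branching a v k n X) \<le> (1 + a) ^ n" for X
    using branching_bounds[OF assms(1), of v k n X] unfolding real_norm_def by linarith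
  then show ?thesis
    using assms by (intro P.integrable_const_bound[of _ "(1 + a) ^ n"] branching_measurable) auto
qed

text \<open>Factors after \<open>k\<close> see the first k + 1 points only as a set with the marked
  point \<open>v\<close>, so exchanging two others changes nothing.\<close>

lemma branching_swap:
  assumes "u < k" "u \<noteq> v" "v < k" "k < n"
  shows "branching a v (Suc k) n (X \<circ> Transposition.transpose u k) = branching a v (Suc k) n X"
proof -
  let ?t = "Transposition.transpose u k"
  have "serves (X \<circ> ?t) v w = serves X v w" if "w \<in> {Suc k..<n}" for w
  proof -
    have "?t w = w" "?t v = v"
      using assms that by (auto simp: Transposition.transpose_def)
    moreover have "?t ` {..<w} = {..<w}"
    proof -
      have "?t ` {..<w} \<subseteq> {..<w}" using assms that by (auto simp: Transposition.transpose_def)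
      moreover have "{..<w} \<subseteq> ?t ` {..<w}"
      proof
        fix x assume "x \<in> {..<w}"
        then have "?t x \<in> {..<w}" using assms that by (auto simp: Transposition.transpose_def)
        then have "?t (?t x) \<in> ?t ` {..<w}" by (rule imageI)
        then show "x \<in> ?t ` {..<w}" by simp
      qed
      ultimately show ?thesis by auto
    qed
    then have "(\<forall>x<w. D (X w) (X v) \<le> D (X w) (X (?t x))) \<longleftrightarrow> (\<forall>x<w. D (X w) (X v) \<le> D (X w) (X x))"
      by (metis (no_types, lifting) imageE imageI lessThan_iff)
    ultimately show ?thesis by (simp add: serves_def)
  qed
  then show ?thesis unfolding branching_def by (intro prod.cong) auto
qed

text \<open>After the exchange the point of \<open>u\<close> arrives at time \<open>k\<close>, and
  it is served by \<open>v\<close> exactly when \<open>v\<close> is nearest to it among the other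
  points up to label \<open>k\<close>. The labels counted thus form a family as in
  \<open>kissing\<close> around the point of \<open>v\<close>.\<close>

lemma card_serving_swaps_le:
  assumes "v < k" "\<And>u. u \<in> {..k} - {v} \<Longrightarrow> 0 < D (X u) (X v)"
  shows "card {u \<in> {..k} - {v}. serves (X \<circ> Transposition.transpose u k) v k} \<le> \<kappa>"
proof (rule kissing)
  let ?U = "{u \<in> {..k} - {v}. serves (X \<circ> Transposition.transpose u k) v k}"
  show "finite ?U" by auto
  show "0 < D (X u) (X v)" if "u \<in> ?U" for u using that assms by auto
  show "D (X u) (X v) \<le> D (X u) (X u')" if "u \<in> ?U" "u' \<in> ?U" "u \<noteq> u'" for u u'
  proof -
    let ?t = "Transposition.transpose u k"
    have "?t u' < k" using that by (auto simp: Transposition.transpose_def)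
    moreover have "serves (X \<circ> ?t) v k" using that by auto
    ultimately have "D (X (?t k)) (X (?t v)) \<le> D (X (?t k)) (X (?t (?t u')))"
      unfolding serves_def by (metis comp_apply)
    moreover have "?t v = v" using that assms by (auto simp: Transposition.transpose_def)
    ultimately show ?thesis by simp
  qed
qed

text \<open>Given the set of the first \<open>k + 1\<close> points, each of them other than \<open>v\<close> is equally likely
  to be the last arrival, and at most \<open>\<kappa>\<close> of them would attach to \<open>v\<close>. Later attachments to
  \<open>v\<close> do not see the order of these points.\<close>

lemma integral_branching_step:
  assumes "v < k" "k < n" "0 \<le> a"
  shows "(\<integral>X. branching a v k n X \<partial>points n) \<le>
    (1 + a * \<kappa> / k) * (\<integral>X. branching a v (Suc k) n X \<partial>points n)"
proof -
  interpret P: prob_space "points n" by (rule prob_space_points)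
  define S where "S = branching a v (Suc k) n"
  define Z where "Z u X = (of_bool (serves (X \<circ> Transposition.transpose u k) v k) :: real)" for u X
  let ?U = "{..k} - {v}"
  have S: "integrable (points n) S" "\<And>X. 1 \<le> S X" "\<And>X. S X \<le> (1 + a) ^ n" "S \<in> borel_measurable (points n)"
    unfolding S_def using assms by (auto intro: branching_integrable branching_bounds branching_measurable)
  have Zm: "Z u \<in> borel_measurable (points n)" if "u \<in> ?U" for u
    unfolding Z_def[abs_def] using measurable_compose[OF comp_transpose_measurable(1)[of u n k] serves_measurable[of v n k]] that assms by auto
  have ZS: "integrable (points n) (\<lambda>X. Z u X * S X)" if "u \<in> ?U" for u
  proof (rule Bochner_Integration.integrable_bound[OF S(1)])
    show "(\<lambda>X. Z u X * S X) \<in> borel_measurable (points n)"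
      using Zm[OF that] S(4) by (rule borel_measurable_times)
    show "AE X in points n. norm (Z u X * S X) \<le> norm (S X)"
      by (intro AE_I2) (simp add: Z_def)
  qed
  have kU: "k \<in> ?U" using assms by auto
  have Zk: "Z k X = of_bool (serves X v k)" for X by (simp add: Z_def Transposition.transpose_def)
  \<comment> \<open>\<open>S\<close> is invariant under exchanging \<open>u\<close> and
    \<open>k\<close>, so every candidate for the last arrival contributes the same integral.\<close>
  have eqZ: "(\<integral>X. Z u X * S X \<partial>points n) = (\<integral>X. Z k X * S X \<partial>points n)" if "u \<in> ?U" for u
  proof (cases "u = k")
    case False
    have "(\<integral>X. Z k (X \<circ> Transposition.transpose u k) * S (X \<circ> Transposition.transpose u k) \<partial>points n) = (\<integral>X. Z k X * S X \<partial>points n)"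
      using that assms Zm[OF kU] S(4) by (intro integral_swap) auto
    moreover have "S (X \<circ> Transposition.transpose u k) = S X" for X
      unfolding S_def using that False assms by (intro branching_swap) auto
    moreover have "Z k (X \<circ> Transposition.transpose u k) = Z u X" for X
      unfolding Zk by (simp add: Z_def)
    ultimately show ?thesis by simp
  qed simp
  have AE_U: "AE X in points n. \<forall>u\<in>?U. 0 < D (X u) (X v)"
    using assms by (intro AE_finite_allI AE_D_pos) auto
  \<comment> \<open>Of the k + 1 labels up to \<open>k\<close> only \<open>v\<close> is excluded,
    which leaves exactly \<open>k\<close> candidates.\<close>
  have "real k * (\<integral>X. Z k X * S X \<partial>points n) = (\<Sum>u\<in>?U. \<integral>X. Z u X * S X \<partial>points n)"
  proof -
    have "(\<Sum>u\<in>?U. \<integral>X. Z u X * S X \<partial>points n) = (\<Sum>u\<in>?U. \<integral>X. Z k X * S X \<partial>points n)"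
      by (intro sum.cong refl eqZ)
    then show ?thesis using assms by simp
  qed
  also have "\<dots> = (\<integral>X. (\<Sum>u\<in>?U. Z u X * S X) \<partial>points n)"
    by (intro Bochner_Integration.integral_sum[symmetric] ZS)
  also have "\<dots> \<le> (\<integral>X. \<kappa> * S X \<partial>points n)"
  proof (intro integral_mono_AE Bochner_Integration.integrable_sum ZS)
    show "integrable (points n) (\<lambda>X. \<kappa> * S X)" using S by simp
    show "AE X in points n. (\<Sum>u\<in>?U. Z u X * S X) \<le> \<kappa> * S X"
      using AE_U
    proof eventually_elim
      fix X assume "\<forall>u\<in>?U. 0 < D (X u) (X v)"
      then have "card {u \<in> ?U. serves (X \<circ> Transposition.transpose u k) v k} \<le> \<kappa>"
        using assms by (intro card_serving_swaps_le) auto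
      moreover have "(\<Sum>u\<in>?U. Z u X) = card {u \<in> ?U. serves (X \<circ> Transposition.transpose u k) v k}"
        unfolding Z_def by (simp add: sum_of_bool_eq Int_def)
      ultimately have "(\<Sum>u\<in>?U. Z u X) \<le> \<kappa>" by simp
      then show "(\<Sum>u\<in>?U. Z u X * S X) \<le> \<kappa> * S X"
        unfolding sum_distrib_right[symmetric] using S(2)[of X] by (intro mult_right_mono) auto
    qed
  qed
  also have "\<dots> = \<kappa> * (\<integral>X. S X \<partial>points n)" by simp
  finally have *: "(\<integral>X. Z k X * S X \<partial>points n) \<le> \<kappa> / k * (\<integral>X. S X \<partial>points n)"
    using assms by (simp add: field_simps)
  have "{k..<n} = insert k {Suc k..<n}" using assms by auto
  then have "branching a v k n X = S X + a * (Z k X * S X)" for X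
    by (simp add: branching_def S_def Zk algebra_simps)
  then have "(\<integral>X. branching a v k n X \<partial>points n) = (\<integral>X. S X \<partial>points n) + a * (\<integral>X. Z k X * S X \<partial>points n)"
    using S ZS[OF kU] by simp
  also have "\<dots> \<le> (\<integral>X. S X \<partial>points n) + a * (\<kappa> / k * (\<integral>X. S X \<partial>points n))"
    using * assms by (intro add_left_mono mult_left_mono) auto
  finally show ?thesis by (simp add: S_def algebra_simps)
qed

end

section \<open>Moments of the number of children\<close>

text \<open>The square of each factor is at most (2w + 1) / (2w - 1), and these ratios telescope;
  the telescoped value is relaxed only at the end.\<close>

lemma prod_one_plus_half_le:
  assumes "v < n"
  shows "(\<Prod>w\<in>{Suc v..<n}. 1 + 1 / (2 * real w)) \<le> sqrt (2 * real n / (real v + 1))"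
proof -
  have "(\<Prod>w\<in>{Suc v..<n}. 1 + 1 / (2 * real w)) \<le> sqrt ((2 * real n - 1) / (2 * real v + 1))"
    using Suc_leI[OF assms]
  proof (induction n rule: dec_induct)
    case base
    then show ?case by simp
  next
    case (step n)
    have n: "1 \<le> real n" using step by simp
    have "(1 + 1 / (2 * real n))\<^sup>2 \<le> (2 * real n + 1) / (2 * real n - 1)"
      using n by (simp add: field_simps power2_eq_square)
    then have le: "1 + 1 / (2 * real n) \<le> sqrt ((2 * real n + 1) / (2 * real n - 1))"
      by (rule real_le_rsqrt)
    have "(\<Prod>w\<in>{Suc v..<Suc n}. 1 + 1 / (2 * real w)) = (\<Prod>w\<in>{Suc v..<n}. 1 + 1 / (2 * real w)) * (1 + 1 / (2 * real n))"
      using step by simp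
    also have "\<dots> \<le> sqrt ((2 * real n - 1) / (2 * real v + 1)) * sqrt ((2 * real n + 1) / (2 * real n - 1))"
      using le n step.IH by (intro mult_mono) auto
    also have "\<dots> = sqrt ((2 * real (Suc n) - 1) / (2 * real v + 1))"
    proof -
      have "x / q * (y / x) = y / q" if "x \<noteq> 0" for x y q :: real using that by simp
      from this[of "2 * real n - 1" "2 * real v + 1" "2 * real n + 1"] n show ?thesis
        unfolding real_sqrt_mult[symmetric] by simp
    qed
    finally show ?case .
  qed
  also have "\<dots> \<le> sqrt (2 * real n / (real v + 1))"
    using assms by (intro real_sqrt_le_mono frac_le) auto
  finally show ?thesis .
qed

text \<open>Each term is at most twice the increment of the square root, because consecutive roots
  \<open>a\<close> and \<open>b\<close> satisfy \<open>0 \<le> (b - a)^2\<close>.\<close>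

lemma sum_inverse_sqrt_le: "(\<Sum>v<m. 1 / sqrt (real v + 1)) \<le> 2 * sqrt (real m)"
proof (induction m)
  case (Suc m)
  define a b where "a = sqrt (real m)" and "b = sqrt (real m + 1)"
  have ab: "b\<^sup>2 = a\<^sup>2 + 1" "0 < b" "0 \<le> a" by (auto simp: a_def b_def)
  have "0 \<le> (b - a)\<^sup>2" by simp
  then have "2 * a * b + 1 \<le> 2 * b\<^sup>2" using ab(1) by (simp add: power2_diff algebra_simps)
  then have "2 * a + 1 / b \<le> 2 * b" using ab by (simp add: field_simps power2_eq_square)
  then show ?case using Suc by (simp add: a_def b_def add.commute)
qed simp

lemma ln_ratio_le_sum_inverse:
  assumes "0 < m" "m \<le> n"
  shows "ln (real n / real m) \<le> (\<Sum>w\<in>{m..<n}. 1 / real w)"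
  using assms(2)
proof (induction n rule: dec_induct)
  case (step n)
  have n: "0 < real n" using step assms by simp
  have "ln (real (Suc n) / real m) = ln (1 + 1 / real n) + ln (real n / real m)"
  proof -
    have "real (Suc n) / real m = (1 + 1 / real n) * (real n / real m)"
      using n assms by (simp add: field_simps)
    moreover have "0 < 1 + 1 / real n" "0 < real n / real m"
      using n assms by (auto intro: add_pos_pos)
    ultimately show ?thesis by (simp only: ln_mult_pos)
  qed
  also have "ln (1 + 1 / real n) \<le> 1 / real n"
    using n by (intro ln_add_one_self_le_self) auto
  finally show ?case using step by simp
qed (use assms in auto)

text \<open>Every term from \<open>m\<close> on is at most \<open>p m\<close>, which is at most the
  average of the first \<open>m\<close> terms; multiplied out, this compares the averages over two
  prefixes.\<close>

lemma sum_antimono_average: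
  fixes p :: "nat \<Rightarrow> real"
  assumes "m \<le> w" and "\<And>u v. u < v \<Longrightarrow> v < w \<Longrightarrow> p v \<le> p u"
  shows "real m * (\<Sum>v<w. p v) \<le> real w * (\<Sum>v<m. p v)"
proof (cases "m = w")
  case False
  then have m: "m < w" using assms by simp
  have "p v \<le> p m" if "v \<in> {m..<w}" for v
    using assms(2)[of m v] that by (cases "v = m") auto
  then have 1: "(\<Sum>v\<in>{m..<w}. p v) \<le> real (w - m) * p m"
    using sum_mono[of "{m..<w}" p "\<lambda>_. p m"] by simp
  have "(\<Sum>v<m. p m) \<le> (\<Sum>v<m. p v)"
    using assms(2) m by (intro sum_mono) auto
  then have 2: "real m * p m \<le> (\<Sum>v<m. p v)" by simp
  have "{..<w} = {..<m} \<union> {m..<w}" using m by auto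
  then have "(\<Sum>v<w. p v) = (\<Sum>v<m. p v) + (\<Sum>v\<in>{m..<w}. p v)"
    by (simp add: sum.union_disjoint ivl_disj_int)
  then have "real m * (\<Sum>v<w. p v) \<le> real m * (\<Sum>v<m. p v) + real (w - m) * (real m * p m)"
    using mult_left_mono[OF 1, of "real m"] by (simp add: algebra_simps)
  also have "\<dots> \<le> real m * (\<Sum>v<m. p v) + real (w - m) * (\<Sum>v<m. p v)"
    using 2 by (intro add_left_mono mult_left_mono) auto
  also have "\<dots> = real w * (\<Sum>v<m. p v)" using m by (simp add: algebra_simps of_nat_diff)
  finally show ?thesis .
qed simp

section \<open>Exponential moments, upper tail and variance\<close>

context nn_points
begin

text \<open>The increment \<open>a = 1 / (2 * \<kappa>)\<close> turns the factor
  \<open>1 + a * \<kappa> / w\<close> into \<open>1 + 1 / (2 * w)\<close>, so the products grow like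
  the square root of \<open>n / v\<close>. An exponent below 1 keeps their sum over \<open>v\<close>
  linear in \<open>n\<close>.\<close>

definition \<beta> :: real where "\<beta> = 1 + 1 / (2 * real \<kappa>)"

lemma \<beta>_gt_1: "1 < \<beta>"
  using \<kappa>_pos by (simp add: \<beta>_def)

lemma ln_\<beta>_pos: "0 < ln \<beta>"
  using \<beta>_gt_1 by simp

lemma \<beta>_power: "\<beta> ^ t = exp (ln \<beta> * real t)"
  using \<beta>_gt_1 by (simp add: exp_of_nat2_mult)

text \<open>The rate is halved so that the square of this bound is still a multiple of
  \<open>\<beta> ^ t\<close>.\<close>

lemma le_\<beta>_power: "real t \<le> 2 / ln \<beta> * exp (ln \<beta> * real t / 2)"
proof -
  have "ln \<beta> * real t / 2 \<le> exp (ln \<beta> * real t / 2)"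
    using exp_ge_add_one_self[of "ln \<beta> * real t / 2"] by linarith
  then show ?thesis using ln_\<beta>_pos by (simp add: field_simps)
qed

text \<open>Downward induction from the empty product at \<open>k = n\<close>, with one
  \<open>integral_branching_step\<close> per arrival.\<close>

lemma integral_branching_le:
  fixes a :: real
  assumes "v < k" "k \<le> n" "0 \<le> a"
  shows "(\<integral>X. branching a v k n X \<partial>points n) \<le> (\<Prod>w\<in>{k..<n}. 1 + a * real \<kappa> / real w)"
  using assms(2,1)
proof (induction k rule: inc_induct)
  case base
  interpret P: prob_space "points n" by (rule prob_space_points)
  show ?case by (simp add: branching_def P.prob_space)
next
  case (step k)
  have "(\<integral>X. branching a v k n X \<partial>points n) \<le> (1 + a * \<kappa> / k) * (\<integral>X. branching a v (Suc k) n X \<partial>points n)"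
    using step assms by (intro integral_branching_step) auto
  also have "\<dots> \<le> (1 + a * \<kappa> / k) * (\<Prod>w\<in>{Suc k..<n}. 1 + a * real \<kappa> / real w)"
    using step assms by (intro mult_left_mono) auto
  also have "\<dots> = (\<Prod>w\<in>{k..<n}. 1 + a * real \<kappa> / real w)"
    using step by (simp add: prod.atLeast_Suc_lessThan)
  finally show ?case .
qed

lemma \<beta>_power_children_measurable [measurable]:
  "(\<lambda>X. \<beta> ^ card (children D S n X v)) \<in> borel_measurable (points n)"
  unfolding \<beta>_power using card_children_measurable by measurable

lemma \<beta>_power_children_integrable:
  "integrable (points n) (\<lambda>X. \<beta> ^ card (children D S n X v))"
proof -
  interpret P: prob_space "points n" by (rule prob_space_points)
  show ?thesis
    using \<beta>_gt_1
    by (intro P.integrable_const_bound[of _ "\<beta> ^ n"] AE_I2) (auto intro!: power_increasing card_children_le)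
qed

lemma card_children_integrable:
  "integrable (points n) (\<lambda>X. real (card (children D S n X v)))"
proof -
  interpret P: prob_space "points n" by (rule prob_space_points)
  show ?thesis
    by (intro P.integrable_const_bound[of _ n] card_children_measurable AE_I2) (simp add: card_children_le)
qed

lemma card_high_degree_integrable:
  "integrable (points n) (\<lambda>X. real (card (high_degree D S n i X)))"
proof -
  interpret P: prob_space "points n" by (rule prob_space_points)
  show ?thesis
    by (intro P.integrable_const_bound[of _ n] card_high_degree_measurable AE_I2) (simp add: card_high_degree_le)
qed

lemma integral_\<beta>_power_children_le:
  assumes "v < n"
  shows "(\<integral>X. \<beta> ^ card (children D {} n X v) \<partial>points n) \<le> sqrt (2 * real n / (real v + 1))"
proof -
  let ?a = "1 / (2 * real \<kappa>)"
  have le: "\<beta> ^ card (children D {} n X v) \<le> branching ?a v (Suc v) n X" for X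
  proof -
    have "1 + ?a * of_bool b = (if b then \<beta> else 1)" for b by (simp add: \<beta>_def)
    then have "branching ?a v (Suc v) n X = \<beta> ^ card {w \<in> {Suc v..<n}. serves X v w}"
      unfolding branching_def by (simp add: prod.If_cases Int_def)
    moreover have "children D {} n X v \<subseteq> {w \<in> {Suc v..<n}. serves X v w}"
      using children_serves by (auto simp: children_def)
    then have "card (children D {} n X v) \<le> card {w \<in> {Suc v..<n}. serves X v w}"
      by (intro card_mono) auto
    ultimately show ?thesis using \<beta>_gt_1 by (simp add: power_increasing)
  qed
  have "(\<integral>X. \<beta> ^ card (children D {} n X v) \<partial>points n) \<le> (\<integral>X. branching ?a v (Suc v) n X \<partial>points n)"
    by (intro integral_mono \<beta>_power_children_integrable branching_integrable le) auto
  also have "\<dots> \<le> (\<Prod>w\<in>{Suc v..<n}. 1 + ?a * real \<kappa> / real w)"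
    using assms by (intro integral_branching_le) auto
  also have "\<dots> = (\<Prod>w\<in>{Suc v..<n}. 1 + 1 / (2 * real w))"
    using \<kappa>_pos by simp
  also have "\<dots> \<le> sqrt (2 * real n / (real v + 1))"
    by (rule prod_one_plus_half_le) fact
  finally show ?thesis .
qed

text \<open>The case \<open>m = n\<close> feeds the tail and variance bounds; smaller
  \<open>m\<close> controls the earliest vertices in the lower bound.\<close>

lemma sum_integral_\<beta>_power_children_le:
  assumes "m \<le> n"
  shows "(\<Sum>v<m. \<integral>X. \<beta> ^ card (children D {} n X v) \<partial>points n) \<le> 3 * sqrt (real n * real m)"
proof -
  have "(\<Sum>v<m. \<integral>X. \<beta> ^ card (children D {} n X v) \<partial>points n) \<le> (\<Sum>v<m. sqrt (2 * real n / (real v + 1)))"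
    using assms by (intro sum_mono integral_\<beta>_power_children_le) auto
  also have "\<dots> = sqrt (2 * real n) * (\<Sum>v<m. 1 / sqrt (real v + 1))"
    by (simp add: sum_distrib_left real_sqrt_divide add.commute)
  also have "\<dots> \<le> sqrt (2 * real n) * (2 * sqrt (real m))"
    by (intro mult_left_mono sum_inverse_sqrt_le) auto
  also have "\<dots> = (2 * sqrt 2) * sqrt (real n * real m)"
    by (simp add: real_sqrt_mult)
  also have "\<dots> \<le> 3 * sqrt (real n * real m)"
  proof -
    have "2 * sqrt 2 \<le> (3::real)"
      by (rule power2_le_imp_le) (auto simp: power_mult_distrib)
    then show ?thesis by (intro mult_right_mono) auto
  qed
  finally show ?thesis .
qed

text \<open>Markov's inequality for \<open>\<beta>\<close> to the power of the degree; the extra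
  factor \<open>\<beta>\<close> pays for the edge to the parent.\<close>

lemma expected_high_degree_le:
  "\<beta> ^ i * (\<integral>X. real (card (high_degree D {} n i X)) \<partial>points n) \<le> 3 * \<beta> * real n"
proof -
  have le: "\<beta> ^ i * real (card (high_degree D {} n i X)) \<le> (\<Sum>v<n. \<beta> * \<beta> ^ card (children D {} n X v))" for X
  proof -
    have "\<beta> ^ i * real (card (high_degree D {} n i X)) = (\<Sum>v\<in>high_degree D {} n i X. \<beta> ^ i)" by simp
    also have "\<dots> \<le> (\<Sum>v\<in>high_degree D {} n i X. \<beta> * \<beta> ^ card (children D {} n X v))"
    proof (rule sum_mono)
      fix v assume "v \<in> high_degree D {} n i X"
      then have "i \<le> card (children D {} n X v) + of_bool (0 < v)" by (simp only: high_degree_def mem_Collect_eq)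
      also have "\<dots> \<le> Suc (card (children D {} n X v))" by simp
      finally show "\<beta> ^ i \<le> \<beta> * \<beta> ^ card (children D {} n X v)"
        unfolding power_Suc[symmetric] using \<beta>_gt_1 by (intro power_increasing) auto
    qed
    also have "\<dots> \<le> (\<Sum>v<n. \<beta> * \<beta> ^ card (children D {} n X v))"
      using \<beta>_gt_1 by (intro sum_mono2) (auto simp: high_degree_def)
    finally show ?thesis .
  qed
  have "\<beta> ^ i * (\<integral>X. real (card (high_degree D {} n i X)) \<partial>points n)
      = (\<integral>X. \<beta> ^ i * real (card (high_degree D {} n i X)) \<partial>points n)"
    by simp
  also have "\<dots> \<le> (\<integral>X. (\<Sum>v<n. \<beta> * \<beta> ^ card (children D {} n X v)) \<partial>points n)"
    by (intro integral_mono le integrable_mult_right Bochner_Integration.integrable_sum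
      card_high_degree_integrable \<beta>_power_children_integrable)
  also have "\<dots> = \<beta> * (\<Sum>v<n. \<integral>X. \<beta> ^ card (children D {} n X v) \<partial>points n)"
    by (subst Bochner_Integration.integral_sum)
       (auto intro!: integrable_mult_right \<beta>_power_children_integrable simp: sum_distrib_left)
  also have "\<dots> \<le> \<beta> * (3 * sqrt (real n * real n))"
    using \<beta>_gt_1 by (intro mult_left_mono sum_integral_\<beta>_power_children_le) auto
  finally show ?thesis by simp
qed

text \<open>Efron--Stein with the deletion of \<open>u\<close> as comparison: the squared change is
  quadratic in the number of children, hence at most a constant times \<open>\<beta>\<close> to that
  number, whose expectations sum to a multiple of \<open>n\<close>.\<close>

lemma variance_high_degree_le:
  "(\<integral>X. (real (card (high_degree D {} n i X)))\<^sup>2 \<partial>points n) - (\<integral>X. real (card (high_degree D {} n i X)) \<partial>points n)\<^sup>2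
    \<le> 3 * (2 + 2 / ln \<beta>)\<^sup>2 * real n"
proof -
  let ?f = "\<lambda>S X. real (card (high_degree D S n i X))"
  let ?K = "(2 + 2 / ln \<beta>)\<^sup>2"
  interpret P: prob_space "points n" by (rule prob_space_points)
  have pt: "(?f {} X - ?f {u} X)\<^sup>2 \<le> ?K * \<beta> ^ card (children D {} n X u)" if "u < n" for u X
  proof -
    let ?t = "card (children D {} n X u)"
    have "\<bar>?f {} X - ?f {u} X\<bar> \<le> 2 + real ?t"
      by (rule high_degree_remove_vertex[OF that])
    \<comment> \<open>Both summands are compared with the exponential of half rate, whose square is
      \<open>\<beta> ^ ?t\<close>.\<close>
    also have "\<dots> \<le> 2 * exp (ln \<beta> * real ?t / 2) + 2 / ln \<beta> * exp (ln \<beta> * real ?t / 2)"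
      using ln_\<beta>_pos by (intro add_mono le_\<beta>_power) auto
    also have "\<dots> = (2 + 2 / ln \<beta>) * exp (ln \<beta> * real ?t / 2)"
      by (simp add: algebra_simps)
    finally have "\<bar>?f {} X - ?f {u} X\<bar> \<le> (2 + 2 / ln \<beta>) * exp (ln \<beta> * real ?t / 2)" .
    from power_mono[OF this abs_ge_zero, of 2]
    have "(?f {} X - ?f {u} X)\<^sup>2 \<le> ((2 + 2 / ln \<beta>) * exp (ln \<beta> * real ?t / 2))\<^sup>2"
      by simp
    also have "\<dots> = ?K * \<beta> ^ ?t"
      by (simp add: power_mult_distrib \<beta>_power exp_double[symmetric])
    finally show ?thesis .
  qed
  have bnd: "\<bar>?f S X\<bar> \<le> real n" for S X using card_high_degree_le[of D S n i X] by simp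
  have "(\<integral>X. (?f {} X)\<^sup>2 \<partial>points n) - (\<integral>X. ?f {} X \<partial>points n)\<^sup>2
      \<le> (\<Sum>u\<in>{..<n}. \<integral>X. (?f {} X - ?f {u} X)\<^sup>2 \<partial>points n)"
    by (intro efron_stein[where B = n] card_high_degree_measurable bnd prob_space_axioms)
       (auto simp: high_degree_removed_upd)
  also have "\<dots> \<le> (\<Sum>u\<in>{..<n}. ?K * (\<integral>X. \<beta> ^ card (children D {} n X u) \<partial>points n))"
  proof (rule sum_mono)
    fix u assume u: "u \<in> {..<n}"
    have "(\<integral>X. (?f {} X - ?f {u} X)\<^sup>2 \<partial>points n) \<le> (\<integral>X. ?K * \<beta> ^ card (children D {} n X u) \<partial>points n)"
    proof (rule integral_mono)
      show int: "integrable (points n) (\<lambda>X. ?K * \<beta> ^ card (children D {} n X u))"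
        by (intro integrable_mult_right \<beta>_power_children_integrable)
      show "integrable (points n) (\<lambda>X. (?f {} X - ?f {u} X)\<^sup>2)"
      proof (rule Bochner_Integration.integrable_bound[OF int])
        show "(\<lambda>X. (?f {} X - ?f {u} X)\<^sup>2) \<in> borel_measurable (points n)"
          by (intro borel_measurable_power borel_measurable_diff card_high_degree_measurable)
        show "AE X in points n. norm ((?f {} X - ?f {u} X)\<^sup>2) \<le> norm (?K * \<beta> ^ card (children D {} n X u))"
          using pt u by (intro AE_I2) (auto intro: order.trans[OF _ abs_ge_self])
      qed
    qed (use pt u in auto)
    then show "(\<integral>X. (?f {} X - ?f {u} X)\<^sup>2 \<partial>points n) \<le> ?K * (\<integral>X. \<beta> ^ card (children D {} n X u) \<partial>points n)"
      by simp
  qed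
  also have "\<dots> = ?K * (\<Sum>u<n. \<integral>X. \<beta> ^ card (children D {} n X u) \<partial>points n)"
    by (simp add: sum_distrib_left)
  also have "\<dots> \<le> ?K * (3 * sqrt (real n * real n))"
    by (intro mult_left_mono sum_integral_\<beta>_power_children_le) auto
  finally show ?thesis by (simp add: algebra_simps)
qed

section \<open>Lower bound for the mean\<close>

text \<open>Exchanging \<open>u\<close> and \<open>v\<close> maps the event for \<open>v\<close>
  into the event for \<open>u\<close>, since ties favour the smaller label.\<close>

lemma prob_nearest_antimono:
  assumes "u < v" "v < w" "w < n"
  shows "(\<integral>X. of_bool (nearest_in D {..<w} X w = v) \<partial>points n)
    \<le> (\<integral>X. of_bool (nearest_in D {..<w} X w = u) \<partial>points n :: real)"
proof -
  interpret P: prob_space "points n" by (rule prob_space_points)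
  let ?t = "Transposition.transpose u v"
  let ?N = "\<lambda>k X. of_bool (nearest_in D {..<w} X w = k) :: real"
  have meas: "?N k \<in> borel_measurable (points n)" for k
  proof -
    have "Measurable.pred (points n) (\<lambda>X. nearest_in D {..<w} X w = k)"
      using measurable_compose[OF nearest_in_measurable[of "{..<w}" n w], of "\<lambda>x. x = k" "count_space UNIV"] assms by auto
    then show ?thesis by auto
  qed
  have imp: "nearest_in D {..<w} (X \<circ> ?t) w = u" if N: "nearest_in D {..<w} X w = v" for X
  proof -
    have ne: "{..<w} \<noteq> {}" using assms by auto
    have v: "D (X w) (X v) \<le> D (X w) (X x)" if "x < w" for x
      using nearest_in_minimizes[OF _ ne, of D X w] that N by auto
    have least: "v \<le> y" if "y < w" "\<And>x. x < w \<Longrightarrow> D (X w) (X y) \<le> D (X w) (X x)" for y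
      unfolding N[symmetric] nearest_in_def by (rule Least_le) (use that in auto)
    have tw: "?t w = w" "?t u = v" using assms by (auto simp: Transposition.transpose_def)
    have tl: "?t x < w" if "x < w" for x using that assms by (auto simp: Transposition.transpose_def)
    show ?thesis
      unfolding nearest_in_def
    proof (rule Least_equality)
      show "u \<in> {..<w} \<and> (\<forall>x\<in>{..<w}. D ((X \<circ> ?t) w) ((X \<circ> ?t) u) \<le> D ((X \<circ> ?t) w) ((X \<circ> ?t) x))"
        using assms v tl by (simp add: tw)
      fix y assume y: "y \<in> {..<w} \<and> (\<forall>x\<in>{..<w}. D ((X \<circ> ?t) w) ((X \<circ> ?t) y) \<le> D ((X \<circ> ?t) w) ((X \<circ> ?t) x))"
      \<comment> \<open>A minimiser below \<open>u\<close> is fixed by the exchange, so it would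
        also be a minimiser for \<open>X\<close> with a label below \<open>v\<close>.\<close>
      show "u \<le> y"
      proof (rule ccontr)
        assume "\<not> u \<le> y"
        then have ty: "?t y = y" using assms by (auto simp: Transposition.transpose_def)
        have "D (X w) (X y) \<le> D (X w) (X v)"
          using y[THEN conjunct2, THEN bspec, of u] assms by (simp add: tw ty)
        then have "v \<le> y"
          using y v by (intro least) (auto intro: order.trans)
        then show False using assms \<open>\<not> u \<le> y\<close> by simp
      qed
    qed
  qed
  have tm: "(\<integral>X. ?N u (X \<circ> ?t) \<partial>points n) = (\<integral>X. ?N u X \<partial>points n)"
    using assms meas by (intro integral_swap) auto
  have int: "integrable (points n) (?N k)" for k
    by (intro P.integrable_const_bound[of _ 1] meas AE_I2) auto
  have mt: "(\<lambda>X. X \<circ> ?t) \<in> measurable (points n) (points n)"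
    using assms by (intro comp_transpose_measurable) auto
  have int2: "integrable (points n) (\<lambda>X. ?N u (X \<circ> ?t))"
    by (intro P.integrable_const_bound[of _ 1] measurable_compose[OF mt meas] AE_I2) auto
  have "(\<integral>X. ?N v X \<partial>points n) \<le> (\<integral>X. ?N u (X \<circ> ?t) \<partial>points n)"
    using imp by (intro integral_mono int int2) auto
  then show ?thesis unfolding tm .
qed

text \<open>Each arrival \<open>w\<close> has one parent among \<open>w\<close> candidates, whose
  probabilities do not increase with the label; so the first \<open>m\<close> together receive at
  least m / w. Summing over \<open>w\<close> from \<open>m\<close> on gives the logarithm.\<close>

lemma expected_children_ge:
  assumes "0 < m" "m \<le> n"
  shows "real m * ln (real n / real m) \<le> (\<Sum>v<m. \<integral>X. real (card (children D {} n X v)) \<partial>points n)"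
proof -
  interpret P: prob_space "points n" by (rule prob_space_points)
  let ?N = "\<lambda>w k X. of_bool (nearest_in D {..<w} X w = k) :: real"
  have int: "integrable (points n) (?N w k)" if "w < n" for k w
  proof -
    have "Measurable.pred (points n) (\<lambda>X. nearest_in D {..<w} X w = k)"
      using measurable_compose[OF nearest_in_measurable[of "{..<w}" n w], of "\<lambda>x. x = k" "count_space UNIV"] that by auto
    then show ?thesis by (intro P.integrable_const_bound[of _ 1] AE_I2) auto
  qed
  have step: "real m / real w \<le> (\<Sum>v<m. \<integral>X. ?N w v X \<partial>points n)" if w: "w \<in> {m..<n}" for w
  proof -
    have "(\<Sum>v<w. ?N w v X) = 1" for X
    proof -
      have "{..<w} \<inter> {v. nearest_in D {..<w} X w = v} = {nearest_in D {..<w} X w}"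
        using nearest_in_less[of w D X] w assms by auto
      then show ?thesis by (simp add: sum_of_bool_eq)
    qed
    then have "(\<Sum>v<w. \<integral>X. ?N w v X \<partial>points n) = 1"
      using w int by (subst Bochner_Integration.integral_sum[symmetric]) (auto simp: P.prob_space)
    moreover have "real m * (\<Sum>v<w. \<integral>X. ?N w v X \<partial>points n) \<le> real w * (\<Sum>v<m. \<integral>X. ?N w v X \<partial>points n)"
      using w by (intro sum_antimono_average prob_nearest_antimono) auto
    ultimately show ?thesis using w assms by (simp add: field_simps)
  qed
  have "real m * ln (real n / real m) \<le> real m * (\<Sum>w\<in>{m..<n}. 1 / real w)"
    using assms by (intro mult_left_mono ln_ratio_le_sum_inverse) auto
  also have "\<dots> = (\<Sum>w\<in>{m..<n}. real m / real w)" by (simp add: sum_distrib_left)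
  also have "\<dots> \<le> (\<Sum>w\<in>{m..<n}. \<Sum>v<m. \<integral>X. ?N w v X \<partial>points n)"
    by (intro sum_mono step)
  also have "\<dots> = (\<Sum>v<m. \<Sum>w\<in>{m..<n}. \<integral>X. ?N w v X \<partial>points n)"
    by (rule sum.swap)
  also have "\<dots> \<le> (\<Sum>v<m. \<integral>X. real (card (children D {} n X v)) \<partial>points n)"
  proof (rule sum_mono)
    fix v assume v: "v \<in> {..<m}"
    have "(\<Sum>w\<in>{m..<n}. \<integral>X. ?N w v X \<partial>points n) = (\<integral>X. (\<Sum>w\<in>{m..<n}. ?N w v X) \<partial>points n)"
      using int by (intro Bochner_Integration.integral_sum[symmetric]) auto
    also have "\<dots> \<le> (\<integral>X. real (card (children D {} n X v)) \<partial>points n)"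
    proof (intro integral_mono card_children_integrable Bochner_Integration.integrable_sum)
      fix X
      have "(\<Sum>w\<in>{m..<n}. ?N w v X) = card ({m..<n} \<inter> {w. nearest_in D {..<w} X w = v})"
        by (simp add: sum_of_bool_eq)
      also have "\<dots> \<le> card (children D {} n X v)"
        using v by (intro of_nat_mono card_mono) (auto simp: children_def)
      finally show "(\<Sum>w\<in>{m..<n}. ?N w v X) \<le> card (children D {} n X v)" .
    qed (use int in auto)
    finally show "(\<Sum>w\<in>{m..<n}. \<integral>X. ?N w v X \<partial>points n) \<le> (\<integral>X. real (card (children D {} n X v)) \<partial>points n)" .
  qed
  finally show ?thesis .
qed

text \<open>The exponential moment bound truncates the number of children at a multiple of its mean, so
  that a large mean forces many vertices among the first \<open>m\<close> to have many children.\<close>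

lemma expected_high_degree_ge_early:
  assumes m: "0 < m" "m \<le> n" and i: "2 * real i \<le> ln (real n / real m)"
    and L: "24 / ln \<beta> \<le> ln (real n / real m)"
  shows "ln \<beta> * real m / 4 \<le> (\<integral>X. real (card (high_degree D {} n i X)) \<partial>points n)"
proof -
  define L where "L = ln (real n / real m)"
  define l where "l = ln \<beta>"
  let ?c = "\<lambda>X v. card (children D {} n X v)"
  let ?f = "\<lambda>X. real (card (high_degree D {} n i X))"
  have l: "0 < l" using ln_\<beta>_pos by (simp add: l_def)
  have L0: "0 < L" using assms(4) l by (auto simp: L_def l_def intro: less_le_trans[of _ "24 / ln \<beta>"])
  have expL: "exp L = real n / real m"
    using m by (auto simp: L_def)
  \<comment> \<open>A count below \<open>i\<close> is covered by the first term, one between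
    \<open>i\<close> and \<open>L / l\<close> by the second, and one above \<open>L / l\<close> by
    the third, where \<open>l * t\<close> exceeds \<open>L\<close> and half of it can be given
    away.\<close>
  have pt: "real t \<le> real i + L / l * of_bool (i \<le> t) + 2 / l * exp (- L / 2) * \<beta> ^ t" for t
  proof -
    have pos: "0 \<le> 2 / l * exp (- L / 2) * \<beta> ^ t" "0 \<le> L / l" using l L0 \<beta>_gt_1 by auto
    consider "t < i" | "i \<le> t" "real t \<le> L / l" | "L / l < real t" by linarith
    then show ?thesis
    proof cases
      case 3
      have "L \<le> l * real t" using 3 l by (simp add: field_simps)
      then have "exp (l * real t / 2) \<le> exp (- L / 2 + l * real t)" by simp
      also have "\<dots> = exp (- L / 2) * \<beta> ^ t" by (simp only: exp_add \<beta>_power l_def)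
      finally have "2 / l * exp (l * real t / 2) \<le> 2 / l * (exp (- L / 2) * \<beta> ^ t)"
        using l by (intro mult_left_mono) auto
      then have "real t \<le> 2 / l * exp (- L / 2) * \<beta> ^ t"
        using le_\<beta>_power[of t] unfolding l_def[symmetric] by linarith
      moreover have "0 \<le> L / l * of_bool (i \<le> t)" using pos by simp
      ultimately show ?thesis by linarith
    qed (use pos in auto)
  qed
  have ptX: "(\<Sum>v<m. real (?c X v)) \<le> real m * real i + L / l * ?f X + 2 / l * exp (- L / 2) * (\<Sum>v<m. \<beta> ^ ?c X v)" for X
  proof -
    have "(\<Sum>v<m. of_bool (i \<le> ?c X v)) = real (card ({..<m} \<inter> {v. i \<le> ?c X v}))"
      by (simp add: sum_of_bool_eq)
    also have "\<dots> \<le> ?f X"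
      using m by (intro of_nat_mono card_mono) (auto simp: high_degree_def)
    finally have "L / l * (\<Sum>v<m. of_bool (i \<le> ?c X v)) \<le> L / l * ?f X"
      using l L0 by (intro mult_left_mono) auto
    moreover have "(\<Sum>v<m. real (?c X v)) \<le> (\<Sum>v<m. real i + L / l * of_bool (i \<le> ?c X v) + 2 / l * exp (- L / 2) * \<beta> ^ ?c X v)"
      by (intro sum_mono pt)
    ultimately show ?thesis by (simp only: sum.distrib sum_distrib_left[symmetric] sum_constant card_lessThan of_nat_mult)
  qed
  \<comment> \<open>Since \<open>sqrt (n * m) = m * exp (L / 2)\<close>, the factor
    \<open>exp (- L / 2)\<close> cancels and the tail costs only a multiple of
    \<open>m\<close>.\<close>
  have key: "exp (- L / 2) * (3 * sqrt (real n * real m)) = 3 * real m"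
  proof -
    have "sqrt (real n * real m) = sqrt (real m ^ 2 * (real n / real m))"
      using m by (simp add: power2_eq_square)
    also have "\<dots> = real m * sqrt (exp L)"
      using m expL by (simp only: real_sqrt_mult real_sqrt_abs abs_of_nat)
    also have "sqrt (exp L) = exp (L / 2)"
      by (rule real_sqrt_unique) (auto simp: exp_double[symmetric])
    finally show ?thesis by (simp add: exp_minus)
  qed
  interpret P: prob_space "points n" by (rule prob_space_points)
  have "real m * L \<le> (\<Sum>v<m. \<integral>X. real (?c X v) \<partial>points n)"
    unfolding L_def by (rule expected_children_ge[OF m])
  also have "\<dots> = (\<integral>X. (\<Sum>v<m. real (?c X v)) \<partial>points n)"
    by (intro Bochner_Integration.integral_sum[symmetric] card_children_integrable)
  also have "\<dots> \<le> (\<integral>X. real m * real i + L / l * ?f X + 2 / l * exp (- L / 2) * (\<Sum>v<m. \<beta> ^ ?c X v) \<partial>points n)"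
    by (intro integral_mono ptX Bochner_Integration.integrable_add integrable_mult_right Bochner_Integration.integrable_sum
       card_children_integrable card_high_degree_integrable \<beta>_power_children_integrable P.integrable_const)
  also have "\<dots> = real m * real i + L / l * (\<integral>X. ?f X \<partial>points n) + 2 / l * exp (- L / 2) * (\<Sum>v<m. \<integral>X. \<beta> ^ ?c X v \<partial>points n)"
    using card_high_degree_integrable \<beta>_power_children_integrable
    by (simp add: P.prob_space)
  also have "\<dots> \<le> real m * (L / 2) + L / l * (\<integral>X. ?f X \<partial>points n) + 2 / l * exp (- L / 2) * (3 * sqrt (real n * real m))"
    using i m l by (intro add_mono mult_left_mono sum_integral_\<beta>_power_children_le) (auto simp: L_def)
  also have "\<dots> = real m * (L / 2) + L / l * (\<integral>X. ?f X \<partial>points n) + 2 / l * (3 * real m)"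
    by (simp only: mult.assoc key)
  finally have "real m * L \<le> real m * (L / 2) + L / l * (\<integral>X. ?f X \<partial>points n) + 2 / l * (3 * real m)" .
  \<comment> \<open>The assumption on 24 enters here: of \<open>real m * L\<close> the tail takes at
    most a quarter and the term with \<open>i\<close> at most a half, which leaves a
    quarter.\<close>
  moreover have "2 / l * (3 * real m) \<le> real m * (L / 4)"
    using mult_left_mono[OF assms(4), of "real m / 4"] by (simp add: L_def l_def)
  ultimately have "real m * (L / 4) \<le> L / l * (\<integral>X. ?f X \<partial>points n)"
    unfolding times_divide_eq_right by linarith
  then have "L * (real m / 4) \<le> L * ((\<integral>X. ?f X \<partial>points n) / l)" by (simp add: field_simps)
  then have "real m / 4 \<le> (\<integral>X. ?f X \<partial>points n) / l" using L0 by (rule mult_left_le_imp_le)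
  then show ?thesis using l by (simp add: field_simps l_def)
qed

text \<open>Taking \<open>m\<close> as the integer part of the displayed quantity satisfies both
  logarithmic conditions of \<open>expected_high_degree_ge_early\<close>. Rounding down a number
  that is at least 1 loses at most a factor 2, whence 8 instead of 4.\<close>

lemma expected_high_degree_ge:
  assumes "1 \<le> real n * exp (- (2 * real i + 24 / ln \<beta>))"
  shows "ln \<beta> / 8 * (real n * exp (- (2 * real i + 24 / ln \<beta>))) \<le> (\<integral>X. real (card (high_degree D {} n i X)) \<partial>points n)"
proof -
  define y where "y = real n * exp (- (2 * real i + 24 / ln \<beta>))"
  define m where "m = nat \<lfloor>y\<rfloor>"
  have y: "1 \<le> y" using assms by (simp add: y_def)
  have my: "real m \<le> y" "y \<le> 2 * real m" "0 < m" 
  proof -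
    have "real m = real_of_int \<lfloor>y\<rfloor>" "1 \<le> real_of_int \<lfloor>y\<rfloor>" using y by (simp_all add: m_def)
    then show "real m \<le> y" "y \<le> 2 * real m" "0 < m"
      using of_int_floor_le[of y] real_of_int_floor_add_one_gt[of y] by linarith+
  qed
  have "0 \<le> 2 * real i + 24 / ln \<beta>" using ln_\<beta>_pos by simp
  then have "exp (- (2 * real i + 24 / ln \<beta>)) \<le> 1" by simp
  then have "y \<le> real n" unfolding y_def by (intro mult_left_le) auto
  then have mn: "m \<le> n" using my by simp
  then have n: "0 < real n" using my by simp
  have "exp (2 * real i + 24 / ln \<beta>) = real n / y" using n unfolding y_def exp_minus by (simp add: divide_inverse)
  also have "\<dots> \<le> real n / real m" using my n by (intro divide_left_mono) auto
  finally have "2 * real i + 24 / ln \<beta> \<le> ln (real n / real m)"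
    using my n by (subst ln_ge_iff) auto
  moreover have "0 < 24 / ln \<beta>" using ln_\<beta>_pos by simp
  ultimately have "ln \<beta> * real m / 4 \<le> (\<integral>X. real (card (high_degree D {} n i X)) \<partial>points n)"
    by (intro expected_high_degree_ge_early my mn) linarith+
  moreover have "ln \<beta> / 8 * y \<le> ln \<beta> / 8 * (2 * real m)"
    using my ln_\<beta>_pos by (intro mult_left_mono) auto
  ultimately show ?thesis unfolding y_def[symmetric] by linarith
qed

end

section \<open>The torus\<close>

definition integer_lattice :: "(real ^ 'd::finite) set" where
  "integer_lattice = {k. \<forall>j. k $ j \<in> \<int>}"

lemma countable_integer_lattice: "countable (integer_lattice :: (real ^ 'd::finite) set)"
proof -
  have "integer_lattice \<subseteq> range (\<lambda>f :: 'd \<Rightarrow> int. \<chi> j. real_of_int (f j))"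
  proof
    fix k :: "real ^ 'd" assume "k \<in> integer_lattice"
    then have "\<forall>j. \<exists>z. k $ j = real_of_int z" by (auto simp: integer_lattice_def elim: Ints_cases)
    then obtain f where "\<And>j. k $ j = real_of_int (f j)" by metis
    then have "k = (\<chi> j. real_of_int (f j))" by (simp add: vec_eq_iff)
    then show "k \<in> range (\<lambda>f :: 'd \<Rightarrow> int. \<chi> j. real_of_int (f j))" by blast
  qed
  moreover have "countable (UNIV :: ('d \<Rightarrow> int) set)" by (rule countableI_type)
  ultimately show ?thesis by (blast intro: countable_subset countable_image)
qed

lemma integer_lattice_nonempty: "integer_lattice \<noteq> {}"
  by (auto simp: integer_lattice_def intro: exI[of _ 0])

lemma torus_dist_le:
  "k \<in> integer_lattice \<Longrightarrow> torus_dist n x y \<le> norm (x - y + torus_side TYPE('d) n *\<^sub>R k)"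
  for x :: "real ^ 'd::finite"
  unfolding torus_dist_def integer_lattice_def by (rule cINF_lower) (auto intro: bdd_belowI[of _ 0])

lemma torus_dist_attained_within:
  fixes x :: "real ^ 'd::finite"
  assumes "torus_dist n x y < r"
  obtains k where "k \<in> integer_lattice" "norm (x - y + torus_side TYPE('d) n *\<^sub>R k) < r"
proof -
  have "(\<lambda>k. norm (x - y + torus_side TYPE('d) n *\<^sub>R k)) ` integer_lattice \<noteq> {}"
    using integer_lattice_nonempty by blast
  from cInf_lessD[OF this, of r] assms show ?thesis
    using that by (auto simp: torus_dist_def integer_lattice_def)
qed

lemma torus_side_pos: "0 < n \<Longrightarrow> 0 < torus_side TYPE('d::finite) n"
  by (simp add: torus_side_def real_root_gt_zero)

text \<open>Distinct points of the half-open cube of side \<open>s\<close> differ in some coordinate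
  by \<open>t\<close> with \<open>0 < t < s\<close>, and adding a multiple of \<open>s\<close>
  cannot bring that difference below the smaller of \<open>t\<close> and \<open>s - t\<close> in
  absolute value.\<close>

lemma torus_dist_pos:
  fixes x y :: "real ^ 'd::finite"
  assumes "0 < n" "x \<in> torus n" "y \<in> torus n" "x \<noteq> y"
  shows "0 < torus_dist n x y"
proof -
  define s where "s = torus_side TYPE('d) n"
  have s: "0 < s" unfolding s_def by (rule torus_side_pos) fact
  obtain j where j: "x $ j \<noteq> y $ j" using assms by (auto simp: vec_eq_iff)
  define t where "t = \<bar>x $ j - y $ j\<bar>"
  have t: "0 < t" "t < s"
    using j assms(2,3) by (auto simp: t_def s_def torus_def abs_if) (smt (verit))+
  have "min t (s - t) \<le> torus_dist n x y"
  proof (rule ccontr)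
    assume "\<not> min t (s - t) \<le> torus_dist n x y"
    then obtain k where k: "k \<in> integer_lattice" "norm (x - y + s *\<^sub>R k) < min t (s - t)"
      unfolding s_def by (meson not_le torus_dist_attained_within)
    have less: "\<bar>x $ j - y $ j + s * k $ j\<bar> < min t (s - t)"
      using component_le_norm_cart[of "x - y + s *\<^sub>R k" j] k(2) by simp
    obtain z where z: "k $ j = real_of_int z"
      using k(1) by (auto simp: integer_lattice_def elim: Ints_cases)
    show False
    proof (cases "z = 0")
      case True
      then show ?thesis using less z by (simp add: t_def)
    next
      case False
      then have "1 \<le> \<bar>real_of_int z\<bar>" by simp
      then have "s \<le> \<bar>s * k $ j\<bar>" using s z by (simp add: abs_mult)
      then show ?thesis using less unfolding t_def by linarith
    qed
  qed
  then show ?thesis using t by linarith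
qed

lemma torus_measurable [measurable]: "(torus n :: (real ^ 'd::finite) set) \<in> sets borel"
proof -
  have [measurable]: "(\<lambda>x :: real ^ 'd. x $ j) \<in> borel_measurable borel" for j
    by (intro borel_measurable_continuous_onI continuous_intros)
  have "{x :: real ^ 'd. 0 \<le> x $ j \<and> x $ j < torus_side TYPE('d) n} \<in> sets borel" for j
    by measurable
  then have "(\<Inter>j\<in>UNIV. {x :: real ^ 'd. 0 \<le> x $ j \<and> x $ j < torus_side TYPE('d) n}) \<in> sets borel"
    by (intro sets.finite_INT) auto
  moreover have "torus n = (\<Inter>j\<in>UNIV. {x :: real ^ 'd. 0 \<le> x $ j \<and> x $ j < torus_side TYPE('d) n})"
    by (auto simp: torus_def)
  ultimately show ?thesis by simp
qed

lemma emeasure_torus: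
  assumes "0 < n"
  shows "emeasure lborel (torus n :: (real ^ 'd::finite) set) \<noteq> 0"
    and "emeasure lborel (torus n :: (real ^ 'd::finite) set) < \<infinity>"
proof -
  define s where "s = torus_side TYPE('d) n"
  have s: "0 < s" unfolding s_def by (rule torus_side_pos) fact
  define u :: "real ^ 'd" where "u = (\<chi> j. s)"
  have ub: "u \<bullet> b = s" if "b \<in> Basis" for b
    using that by (auto simp: Basis_vec_def u_def inner_axis)
  have "emeasure lborel (box 0 u) = ennreal (\<Prod>b\<in>Basis. (u - 0) \<bullet> b)"
    using s by (intro emeasure_lborel_box) (auto simp: ub)
  moreover have "0 < (\<Prod>b\<in>Basis. (u - 0) \<bullet> b)"
    using s by (intro prod_pos) (auto simp: ub)
  ultimately have "0 < emeasure lborel (box 0 u)" by simp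
  also have "\<dots> \<le> emeasure lborel (torus n :: (real ^ 'd) set)"
    by (intro emeasure_mono) (auto simp: torus_def mem_box_cart u_def s_def less_imp_le)
  finally show "emeasure lborel (torus n :: (real ^ 'd) set) \<noteq> 0" by simp
  have "torus n \<subseteq> cbox 0 u" by (auto simp: torus_def mem_box_cart u_def s_def less_imp_le)
  then show "emeasure lborel (torus n :: (real ^ 'd) set) < \<infinity>"
    by (intro emeasure_bounded_finite bounded_subset[OF bounded_cbox])
qed

text \<open>The infimum runs over a countable lattice, so joint measurability passes to it.\<close>

lemma torus_dist_measurable:
  "case_prod (torus_dist n) \<in> borel_measurable (borel \<Otimes>\<^sub>M (borel :: (real ^ 'd::finite) measure))"
proof -
  have "(\<lambda>p. INF k\<in>integer_lattice. norm (fst p - snd p + torus_side TYPE('d) n *\<^sub>R k))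
    \<in> borel_measurable (borel \<Otimes>\<^sub>M (borel :: (real ^ 'd) measure))"
    by (intro borel_measurable_cINF_real countable_integer_lattice) measurable
  then show ?thesis
    by (simp add: torus_dist_def[abs_def] integer_lattice_def case_prod_unfold)
qed

section \<open>The kissing bound on the torus\<close>

text \<open>Split \<open>b - a\<close> into a radial part along \<open>sgn b\<close> and the turn
  from \<open>sgn a\<close> to \<open>sgn b\<close>, which costs less than half of
  \<open>norm a\<close>. The margin \<open>norm a / 2\<close> later absorbs the error of lifts that
  only approach the infimum.\<close>

lemma norm_diff_less_of_small_angle:
  fixes a b :: "'a :: real_normed_vector"
  assumes "a \<noteq> 0" "norm a \<le> norm b" "norm (sgn b - sgn a) < 1 / 2"
  shows "norm (b - a) < norm b - norm a / 2"
proof -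
  have sgn: "norm x *\<^sub>R sgn x = x" for x :: 'a by (cases "x = 0") (simp_all add: sgn_div_norm)
  have "b - a = (norm b - norm a) *\<^sub>R sgn b + norm a *\<^sub>R (sgn b - sgn a)"
    by (simp add: algebra_simps sgn)
  also have "norm \<dots> \<le> norm ((norm b - norm a) *\<^sub>R sgn b) + norm (norm a *\<^sub>R (sgn b - sgn a))"
    by (rule norm_triangle_ineq)
  also have "\<dots> = \<bar>norm b - norm a\<bar> * norm (sgn b) + norm a * norm (sgn b - sgn a)" by simp
  also have "norm (sgn b) = 1" using assms by (auto simp: norm_sgn)
  also have "norm a * norm (sgn b - sgn a) < norm a * (1 / 2)"
    using assms by (intro mult_strict_left_mono) auto
  finally show ?thesis using assms by simp
qed

text \<open>If the displacements from \<open>y\<close> to two points make a small angle, then the farther point is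
  closer to the nearer one than to \<open>y\<close>. So \<open>\<kappa>\<close> is the size of a finite cover of the unit
  sphere by small balls.\<close>

lemma torus_kissing:
  obtains \<kappa> :: nat where "0 < \<kappa>"
    and "\<And>n (U :: nat set) X (y :: real ^ 'd::finite). finite U \<Longrightarrow> (\<And>u. u \<in> U \<Longrightarrow> 0 < torus_dist n (X u) y) \<Longrightarrow>
      (\<And>u u'. u \<in> U \<Longrightarrow> u' \<in> U \<Longrightarrow> u \<noteq> u' \<Longrightarrow> torus_dist n (X u) y \<le> torus_dist n (X u) (X u')) \<Longrightarrow> card U \<le> \<kappa>"
proof -
  have "compact (sphere (0 :: real ^ 'd) 1)" by simp
  \<comment> \<open>With radius 1/4, two directions near the same centre differ by less than 1/2, as
    the angle lemma requires.\<close>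
  then obtain C :: "(real ^ 'd) set" where C: "finite C" "sphere 0 1 \<subseteq> (\<Union>c\<in>C. ball c (1/4))"
    unfolding compact_eq_totally_bounded by (metis zero_less_divide_1_iff zero_less_numeral)
  have "card U \<le> card C + 1"
    if U: "finite U" and pos: "\<And>u. u \<in> U \<Longrightarrow> 0 < torus_dist n (X u) y"
      and sep: "\<And>u u'. u \<in> U \<Longrightarrow> u' \<in> U \<Longrightarrow> u \<noteq> u' \<Longrightarrow> torus_dist n (X u) y \<le> torus_dist n (X u) (X u')"
    for n and U :: "nat set" and X and y :: "real ^ 'd"
  proof (cases "U = {}")
    case False
    define s where "s = torus_side TYPE('d) n"
    \<comment> \<open>Lifts will be chosen within \<open>m\<close> of the infimum; half the least
      distance is at most half the norm of every lift.\<close>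
    define m where "m = Min ((\<lambda>u. torus_dist n (X u) y) ` U) / 2"
    have m: "0 < m" "\<And>u. u \<in> U \<Longrightarrow> m \<le> torus_dist n (X u) y / 2"
      using U False pos by (auto simp: m_def)
    have "\<exists>k. k \<in> integer_lattice \<and> norm (X u - y + s *\<^sub>R k) < torus_dist n (X u) y + m" if "u \<in> U" for u
      using m torus_dist_attained_within[of n "X u" y "torus_dist n (X u) y + m"] by (auto simp: s_def)
    then obtain k where k: "\<And>u. u \<in> U \<Longrightarrow> k u \<in> integer_lattice"
      "\<And>u. u \<in> U \<Longrightarrow> norm (X u - y + s *\<^sub>R k u) < torus_dist n (X u) y + m" by metis
    define \<delta> where "\<delta> u = X u - y + s *\<^sub>R k u" for u
    have \<delta>_ge: "torus_dist n (X u) y \<le> norm (\<delta> u)" if "u \<in> U" for u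
      unfolding \<delta>_def s_def by (rule torus_dist_le[OF k(1)[OF that]])
    then have \<delta>0: "\<delta> u \<noteq> 0" if "u \<in> U" for u using pos[OF that] that by fastforce
    have "\<exists>c\<in>C. norm (sgn (\<delta> u) - c) < 1 / 4" if "u \<in> U" for u
    proof -
      have "sgn (\<delta> u) \<in> sphere 0 1" using \<delta>0[OF that] by (simp add: norm_sgn)
      then obtain c where "c \<in> C" "sgn (\<delta> u) \<in> ball c (1/4)" using C(2) by blast
      then show ?thesis by (intro bexI[of _ c]) (auto simp: dist_norm norm_minus_commute)
    qed
    then obtain c where c: "\<And>u. u \<in> U \<Longrightarrow> c u \<in> C" "\<And>u. u \<in> U \<Longrightarrow> norm (sgn (\<delta> u) - c u) < 1 / 4" by metis
    have separated: False if u: "u \<in> U" "u' \<in> U" "u \<noteq> u'" "c u = c u'" "norm (\<delta> u) \<le> norm (\<delta> u')" for u u'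
    proof -
      have "norm (sgn (\<delta> u') - sgn (\<delta> u)) \<le> norm (sgn (\<delta> u') - c u) + norm (sgn (\<delta> u) - c u)"
        by (rule norm_diff_triangle_le[OF order_refl]) (simp add: norm_minus_commute)
      also have "\<dots> < 1 / 4 + 1 / 4" using c(2)[of u] c(2)[of u'] u by (intro add_strict_mono) auto
      finally have "norm (\<delta> u' - \<delta> u) < norm (\<delta> u') - norm (\<delta> u) / 2"
        using u by (intro norm_diff_less_of_small_angle \<delta>0) auto
      \<comment> \<open>The margin \<open>norm (\<delta> u) / 2\<close> is at least
        \<open>m\<close>, so it covers the excess of the lift \<open>\<delta> u'\<close> over the
        torus distance.\<close>
      also have "\<dots> \<le> torus_dist n (X u') y"
        using k(2)[of u'] \<delta>_ge[of u] m(2)[of u] u unfolding \<delta>_def[symmetric] by linarith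
      also have "\<dots> \<le> torus_dist n (X u') (X u)" using sep u by auto
      \<comment> \<open>Lattice vectors are closed under subtraction, so
        \<open>\<delta> u' - \<delta> u\<close> is a lift of the displacement between the two
        points.\<close>
      also have "\<dots> \<le> norm (X u' - X u + s *\<^sub>R (k u' - k u))"
        unfolding s_def using k(1) u by (intro torus_dist_le) (auto simp: integer_lattice_def)
      also have "X u' - X u + s *\<^sub>R (k u' - k u) = \<delta> u' - \<delta> u" by (simp add: \<delta>_def algebra_simps)
      finally show False by simp
    qed
    have "inj_on c U"
    proof (rule inj_onI, rule ccontr)
      fix u u' assume "u \<in> U" "u' \<in> U" "c u = c u'" "u \<noteq> u'"
      then show False
        using separated[of u u'] separated[of u' u] by (cases "norm (\<delta> u) \<le> norm (\<delta> u')") auto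
    qed
    then have "card U \<le> card C" using c(1) C(1) by (intro card_inj_on_le) auto
    then show ?thesis by simp
  qed simp
  then show ?thesis by (intro that[of "card C + 1"]) auto
qed

text \<open>One \<open>\<kappa>\<close> works for all torus sizes, so the constants derived in the
  locale do not depend on \<open>n\<close>.\<close>

lemma nn_points_torus:
  fixes \<kappa> :: nat
  assumes "0 < n" "0 < \<kappa>"
    and "\<And>n (U :: nat set) X (y :: real ^ 'd::finite). finite U \<Longrightarrow> (\<And>u. u \<in> U \<Longrightarrow> 0 < torus_dist n (X u) y) \<Longrightarrow>
      (\<And>u u'. u \<in> U \<Longrightarrow> u' \<in> U \<Longrightarrow> u \<noteq> u' \<Longrightarrow> torus_dist n (X u) y \<le> torus_dist n (X u) (X u')) \<Longrightarrow> card U \<le> \<kappa>"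
  shows "nn_points (uniform_measure lborel (torus n :: (real ^ 'd) set)) (torus_dist n) \<kappa>"
proof -
  let ?M = "uniform_measure lborel (torus n :: (real ^ 'd) set)"
  interpret prob_space ?M
    using emeasure_torus[OF assms(1), where 'd='d] by (intro prob_space_uniform_measure) auto
  show ?thesis
  proof unfold_locales
    have "sets (?M \<Otimes>\<^sub>M ?M) = sets (borel \<Otimes>\<^sub>M borel)" by (intro sets_pair_measure_cong) auto
    then show "case_prod (torus_dist n) \<in> borel_measurable (?M \<Otimes>\<^sub>M ?M)"
      using torus_dist_measurable by (simp cong: measurable_cong_sets)
    show "AE y in ?M. AE x in ?M. 0 < torus_dist n x y"
    proof (rule AE_uniform_measureI)
      show "AE y in lborel. y \<in> torus n \<longrightarrow> (AE x in ?M. 0 < torus_dist n x y)"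
      proof (rule AE_I2, rule impI)
        fix y :: "real ^ 'd" assume y: "y \<in> torus n"
        show "AE x in ?M. 0 < torus_dist n x y"
        proof (rule AE_uniform_measureI)
          show "AE x in lborel. x \<in> torus n \<longrightarrow> 0 < torus_dist n x y"
            using AE_lborel_singleton[of y] by eventually_elim (use y assms(1) torus_dist_pos in auto)
        qed simp
      qed
    qed simp
    show "card U \<le> \<kappa>"
      if "finite U" "\<And>u. u \<in> U \<Longrightarrow> 0 < torus_dist n (X u) y"
        "\<And>u u'. u \<in> U \<Longrightarrow> u' \<in> U \<Longrightarrow> u \<noteq> u' \<Longrightarrow> torus_dist n (X u) y \<le> torus_dist n (X u) (X u')"
      for U :: "nat set" and X and y :: "real ^ 'd"
      by (rule assms(3)[where n = n and X = X and y = y]) (use that in auto)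
  qed fact
qed

section \<open>Concentration\<close>

text \<open>The allowed deviation is at least \<open>n powr (3/4)\<close>, so by Chebyshev each
  index fails with probability at most \<open>V * n powr (-1/2)\<close>, and at most
  \<open>ln n\<close> indices are in range. Together \<open>good\<close> and \<open>P\<close>
  identify the event with the deviation bounds, which makes it measurable.\<close>

lemma asymptotically_almost_surely_of_variance_bound:
  fixes M :: "nat \<Rightarrow> 'b measure" and f :: "nat \<Rightarrow> nat \<Rightarrow> 'b \<Rightarrow> real" and \<mu> :: "nat \<Rightarrow> nat \<Rightarrow> real"
  assumes prob: "\<And>n. 0 < n \<Longrightarrow> prob_space (M n)"
    and meas: "\<And>n i. 0 < n \<Longrightarrow> f n i \<in> borel_measurable (M n)"
    and bounds: "\<And>n i x. 0 \<le> f n i x" "\<And>n i x. f n i x \<le> real n"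
    and \<mu>: "\<And>n i. \<mu> n i = (\<integral>x. f n i x \<partial>M n)"
    and var: "\<And>n i. 0 < n \<Longrightarrow> (\<integral>x. (f n i x)\<^sup>2 \<partial>M n) - (\<mu> n i)\<^sup>2 \<le> V * real n"
    and lower: "\<And>n i. n \<ge> n1 \<Longrightarrow> 1 \<le> i \<Longrightarrow> real i \<le> c * ln (real n) \<Longrightarrow> real n powr (7/8) \<le> \<mu> n i"
    and c: "0 < c" "c \<le> 1"
    and good: "\<And>n x. n \<ge> n1 \<Longrightarrow>
      (\<And>i. 1 \<le> i \<Longrightarrow> real i \<le> c * ln (real n) \<Longrightarrow> \<bar>f n i x - \<mu> n i\<bar> \<le> real n powr (-1/8) * \<mu> n i) \<Longrightarrow> P n x"
    and P: "\<And>n x i. P n x \<Longrightarrow> 1 \<le> i \<Longrightarrow> real i \<le> c * ln (real n) \<Longrightarrow> \<bar>f n i x - \<mu> n i\<bar> \<le> real n powr (-1/8) * \<mu> n i"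
  shows "asymptotically_almost_surely M P"
proof -
  define N where "N = max n1 2"
  have ge: "1 - ln (real n) * (V * real n powr (-1/2)) \<le> measure (M n) {x \<in> space (M n). P n x}"
    and le: "measure (M n) {x \<in> space (M n). P n x} \<le> 1" if n: "n \<ge> N" for n
  proof -
    have n': "n \<ge> n1" "2 \<le> n" "0 < n" using n by (auto simp: N_def)
    interpret prob_space "M n" by (rule prob) fact
    define I where "I = {i. 1 \<le> i \<and> real i \<le> c * ln (real n)}"
    define \<epsilon> where "\<epsilon> = real n powr (-1/8)"
    define bad where "bad i = {x \<in> space (M n). \<epsilon> * \<mu> n i \<le> \<bar>f n i x - \<mu> n i\<bar>}" for i
    have "0 \<le> ln (real n)" using n' by simp
    have I_sub: "I \<subseteq> {1..nat \<lfloor>ln (real n)\<rfloor>}"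
    proof
      fix i assume "i \<in> I"
      then have "1 \<le> i" "real i \<le> c * ln (real n)" by (auto simp: I_def)
      moreover have "c * ln (real n) \<le> 1 * ln (real n)"
        using c \<open>0 \<le> ln (real n)\<close> by (intro mult_right_mono) auto
      ultimately show "i \<in> {1..nat \<lfloor>ln (real n)\<rfloor>}" by (auto simp: le_nat_iff le_floor_iff)
    qed
    then have fin: "finite I" by (rule finite_subset) simp
    have "card I \<le> nat \<lfloor>ln (real n)\<rfloor>" using card_mono[OF _ I_sub] by simp
    then have cardI: "real (card I) \<le> ln (real n)"
      using \<open>0 \<le> ln (real n)\<close> by (simp add: le_nat_iff le_floor_iff)
    have [measurable]: "f n i \<in> borel_measurable (M n)" for i by (rule meas) fact
    have bad_sets: "bad i \<in> events" for i unfolding bad_def by measurable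
    have int1: "integrable (M n) (f n i)" for i
      using bounds by (intro integrable_const_bound[of _ "real n"] AE_I2) auto
    have int2: "integrable (M n) (\<lambda>x. (f n i x)\<^sup>2)" for i
      using bounds by (intro integrable_const_bound[of _ "(real n)\<^sup>2"] AE_I2) (auto intro: power_mono)
    have var': "variance (f n i) \<le> V * real n" for i
      using var[OF n'(3), of i] unfolding variance_eq[OF int1 int2] \<mu> .
    then have V: "0 \<le> V * real n" using variance_positive[of "f n 0"] by (rule order.trans[rotated])
    have bad_prob: "prob (bad i) \<le> V * real n powr (-1/2)" if "i \<in> I" for i
    proof -
      have \<mu>_ge: "real n powr (7/8) \<le> \<mu> n i" using that n' by (intro lower) (auto simp: I_def)
      have "\<epsilon> * real n powr (7/8) = real n powr (3/4)"
        unfolding \<epsilon>_def powr_add[symmetric] by simp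
      then have a: "real n powr (3/4) \<le> \<epsilon> * \<mu> n i"
        using mult_left_mono[OF \<mu>_ge, of \<epsilon>] by (simp add: \<epsilon>_def)
      have pos: "0 < real n powr (3/4)" using n' by simp
      have a0: "0 < \<epsilon> * \<mu> n i" using a pos by linarith
      have "prob (bad i) \<le> variance (f n i) / (\<epsilon> * \<mu> n i)\<^sup>2"
        using a0 unfolding bad_def \<mu> by (intro Chebyshev_inequality int2) simp_all
      also have "variance (f n i) \<le> V * real n"
        by (rule var')
      also have "V * real n / (\<epsilon> * \<mu> n i)\<^sup>2 \<le> V * real n / (real n powr (3/4))\<^sup>2"
        using V a pos by (intro divide_left_mono power_mono mult_pos_pos[OF zero_less_power[OF a0]]) auto
      also have "(real n powr (3/4))\<^sup>2 = real n * real n powr (1/2)"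
      proof -
        have "(real n powr (3/4))\<^sup>2 = real n powr (3/4 + 3/4)" by (simp only: powr_add power2_eq_square)
        also have "\<dots> = real n powr (1 + 1/2)" by simp
        also have "\<dots> = real n * real n powr (1/2)" using n' by (simp only: powr_add) simp
        finally show ?thesis .
      qed
      also have "V * real n / (real n * real n powr (1/2)) = V * real n powr (-1/2)"
        using n' by (simp add: powr_minus_divide)
      finally show ?thesis using V a by (simp add: divide_right_mono)
    qed
    have "prob (\<Union>i\<in>I. bad i) \<le> (\<Sum>i\<in>I. prob (bad i))"
      using fin bad_sets by (intro finite_measure_subadditive_finite) auto
    also have "\<dots> \<le> (\<Sum>i\<in>I. V * real n powr (-1/2))" by (intro sum_mono bad_prob)
    also have "\<dots> = real (card I) * (V * real n powr (-1/2))" by simp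
    finally have Un: "prob (\<Union>i\<in>I. bad i) \<le> real (card I) * (V * real n powr (-1/2))" .
    have V0: "0 \<le> V * real n powr (-1/2)"
      using V n' by (simp add: zero_le_mult_iff)
    have eq: "{x \<in> space (M n). P n x} = {x \<in> space (M n). \<forall>i\<in>I. \<bar>f n i x - \<mu> n i\<bar> \<le> \<epsilon> * \<mu> n i}"
      using good[OF n'(1)] P unfolding I_def \<epsilon>_def by blast
    have sets: "{x \<in> space (M n). P n x} \<in> events"
      unfolding eq using fin by measurable
    have "space (M n) - (\<Union>i\<in>I. bad i) \<subseteq> {x \<in> space (M n). P n x}"
      unfolding eq by (auto simp: bad_def)
    then have "prob (space (M n) - (\<Union>i\<in>I. bad i)) \<le> prob {x \<in> space (M n). P n x}"
      by (intro finite_measure_mono sets)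
    moreover have "prob (space (M n) - (\<Union>i\<in>I. bad i)) = 1 - prob (\<Union>i\<in>I. bad i)"
      using fin bad_sets by (intro prob_compl) auto
    moreover have "real (card I) * (V * real n powr (-1/2)) \<le> ln (real n) * (V * real n powr (-1/2))"
      using cardI V0 by (intro mult_right_mono) auto
    ultimately show "1 - ln (real n) * (V * real n powr (-1/2)) \<le> measure (M n) {x \<in> space (M n). P n x}"
      using Un by linarith
    show "measure (M n) {x \<in> space (M n). P n x} \<le> 1" by (rule prob_le_1)
  qed
  have lim: "(\<lambda>n. 1 - ln (real n) * (V * real n powr (-1/2))) \<longlonglongrightarrow> 1"
    by real_asymp
  show ?thesis
    unfolding asymptotically_almost_surely_def
  proof (rule tendsto_sandwich[OF _ _ lim tendsto_const])
    show "\<forall>\<^sub>F n in sequentially. 1 - ln (real n) * (V * real n powr (-1/2)) \<le> measure (M n) {x \<in> space (M n). P n x}"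
      using ge by (intro eventually_sequentiallyI)
    show "\<forall>\<^sub>F n in sequentially. measure (M n) {x \<in> space (M n). P n x} \<le> 1"
      using le by (intro eventually_sequentiallyI)
  qed
qed

text \<open>Concentration transfers the lower bound from means to counts. The upper bound comes from
  the means for large \<open>i\<close>, and for bounded \<open>i\<close> from the lower bound on the
  count at 3.\<close>

lemma concentrated_counts_of_moment_bounds:
  fixes M :: "nat \<Rightarrow> 'b measure" and f :: "nat \<Rightarrow> nat \<Rightarrow> 'b \<Rightarrow> real" and \<mu> :: "nat \<Rightarrow> nat \<Rightarrow> real"
  assumes prob: "\<And>n. 0 < n \<Longrightarrow> prob_space (M n)"
    and meas: "\<And>n i. 0 < n \<Longrightarrow> f n i \<in> borel_measurable (M n)"
    and bounds: "\<And>n i x. 0 \<le> f n i x" "\<And>n i x. f n i x \<le> real n"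
    and antimono: "\<And>n i j x. i \<le> j \<Longrightarrow> f n j x \<le> f n i x"
    and f23: "\<And>n x. f n 2 x + f n 3 x \<le> real n"
    and \<mu>: "\<And>n i. \<mu> n i = (\<integral>x. f n i x \<partial>M n)"
    and var: "\<And>n i. 0 < n \<Longrightarrow> (\<integral>x. (f n i x)\<^sup>2 \<partial>M n) - (\<mu> n i)\<^sup>2 \<le> V * real n"
    and upper: "\<And>n i. 0 < n \<Longrightarrow> b ^ i * \<mu> n i \<le> B * real n"
    and lower: "\<And>n i. 0 < n \<Longrightarrow> 1 \<le> real n * exp (- (2 * real i + K)) \<Longrightarrow>
      a * (real n * exp (- (2 * real i + K))) \<le> \<mu> n i"
    and const: "1 < b" "0 < a" "0 \<le> K" "1 \<le> B"
  shows "\<exists>C1 C2 c :: real. 0 < C1 \<and> C1 < C2 \<and> 0 < c \<and>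
    (\<exists>\<epsilon> :: nat \<Rightarrow> real. \<epsilon> \<longlonglongrightarrow> 0 \<and>
      asymptotically_almost_surely M
        (\<lambda>n x. \<forall>i::nat. 1 \<le> i \<and> real i \<le> c * ln (real n) \<longrightarrow>
           real n * exp (- C2 * real i) \<le> f n i x \<and>
           (2 \<le> i \<longrightarrow> f n i x \<le> real n * exp (- C1 * real i)) \<and>
           \<bar>f n i x - \<mu> n i\<bar> \<le> \<epsilon> n * \<mu> n i))"
proof -
  \<comment> \<open>As \<open>1 \<le> i\<close>, both \<open>K\<close> and the factor
    \<open>a\<close> are absorbed into the exponential rate.\<close>
  define C where "C = 2 + K + \<bar>ln a\<bar>"
  \<comment> \<open>The extra 1 pays for the factor 1/2 lost to concentration.\<close>
  define C2 where "C2 = C + 1"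
  \<comment> \<open>This gives \<open>C * i \<le> ln n / 8\<close> in the range considered, so all
    means there are at least \<open>n powr (7/8)\<close>.\<close>
  define c where "c = 1 / (8 * C)"
  define l where "l = ln b"
  \<comment> \<open>A count at 3 of at least \<open>n * exp (- 3 * C2)\<close> leaves at most
    \<open>n * exp (- q)\<close> for the count at 2.\<close>
  define q where "q = - ln (1 - exp (- 3 * C2))"
  \<comment> \<open>From \<open>i0\<close> on, half of the decay rate \<open>l\<close> absorbs the
    factor \<open>2 * B\<close>.\<close>
  define i0 where "i0 = 2 * ln (2 * B) / l"
  \<comment> \<open>The first entry serves \<open>i \<ge> i0\<close>, the second smaller
    \<open>i\<close>, and the third ensures \<open>C1 < C2\<close>.\<close>
  define C1 where "C1 = min (min (l / 2) (q / (\<bar>i0\<bar> + 1))) 1"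
  define \<epsilon> where "\<epsilon> n = real n powr (-1/8)" for n :: nat
  have C: "2 \<le> C" using const by (simp add: C_def)
  have l: "0 < l" using const by (simp add: l_def)
  have q: "0 < q"
  proof -
    have "0 < 1 - exp (- 3 * C2)" "1 - exp (- 3 * C2) < 1" using C by (auto simp: C2_def)
    then have "ln (1 - exp (- 3 * C2)) < 0" by (simp add: ln_less_zero_iff)
    then show ?thesis by (simp add: q_def)
  qed
  have C1: "0 < C1" "C1 < C2" "C1 \<le> l / 2" "C1 \<le> q / (\<bar>i0\<bar> + 1)"
  proof -
    have "0 < q / (\<bar>i0\<bar> + 1)" using q by (intro divide_pos_pos) auto
    then show "0 < C1" "C1 < C2" "C1 \<le> l / 2" "C1 \<le> q / (\<bar>i0\<bar> + 1)"
      unfolding C1_def C2_def using l C by linarith+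
  qed
  have c: "0 < c" "c \<le> 1" using C by (auto simp: c_def)
  \<comment> \<open>The bound by 3 puts \<open>i = 3\<close> into the range of concentration; the
    one on \<open>2 * K\<close> makes \<open>lower\<close> applicable.\<close>
  have "\<forall>\<^sub>F n :: nat in sequentially. 2 * K \<le> ln (real n) \<and> 3 \<le> c * ln (real n) \<and> \<epsilon> n \<le> 1 / 2 \<and> 2 \<le> n"
  proof (intro eventually_conj)
    have "filterlim (\<lambda>n::nat. ln (real n)) at_top sequentially" by real_asymp
    then show "\<forall>\<^sub>F n :: nat in sequentially. 2 * K \<le> ln (real n)" by (auto simp: filterlim_at_top)
    have "filterlim (\<lambda>n::nat. c * ln (real n)) at_top sequentially" using c by real_asymp
    then show "\<forall>\<^sub>F n :: nat in sequentially. 3 \<le> c * ln (real n)" by (auto simp: filterlim_at_top)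
    show "\<forall>\<^sub>F n :: nat in sequentially. \<epsilon> n \<le> 1 / 2" unfolding \<epsilon>_def by real_asymp
    show "\<forall>\<^sub>F n :: nat in sequentially. 2 \<le> n" by (rule eventually_ge_at_top)
  qed
  then obtain n1 where n1: "\<And>n. n \<ge> n1 \<Longrightarrow> 2 * K \<le> ln (real n)" "\<And>n. n \<ge> n1 \<Longrightarrow> 3 \<le> c * ln (real n)"
    "\<And>n. n \<ge> n1 \<Longrightarrow> \<epsilon> n \<le> 1 / 2" "\<And>n. n \<ge> n1 \<Longrightarrow> 2 \<le> n"
    by (auto simp: eventually_sequentially)
  have \<mu>_ge: "real n * exp (- C * real i) \<le> \<mu> n i" "real n powr (7/8) \<le> real n * exp (- C * real i)"
    if n: "n \<ge> n1" and i: "1 \<le> i" "real i \<le> c * ln (real n)" for n i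
  proof -
    have n0: "0 < n" "0 < real n" "0 \<le> ln (real n)" using n1(4)[OF n] by auto
    have Ci: "C * real i \<le> ln (real n) / 8"
      using mult_left_mono[OF i(2), of C] C by (simp add: c_def)
    have "2 * real i \<le> C * real i" using C by (intro mult_right_mono) auto
    then have le: "2 * real i + K \<le> ln (real n)" using Ci n1(1)[OF n] n0 by linarith
    then have "exp (2 * real i + K) \<le> real n" using n0 by (simp add: ln_ge_iff)
    then have "1 \<le> real n * exp (- (2 * real i + K))"
      unfolding exp_minus using n0 by (simp add: field_simps)
    from lower[OF n0(1) this] have lb: "a * (real n * exp (- (2 * real i + K))) \<le> \<mu> n i" .
    have "K * 1 \<le> K * real i" "\<bar>ln a\<bar> * 1 \<le> \<bar>ln a\<bar> * real i"
      by (intro mult_left_mono; use i const in simp)+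
    then have "- C * real i \<le> ln a + - (2 * real i + K)"
      unfolding C_def by (simp add: algebra_simps)
    then have "exp (- C * real i) \<le> exp (ln a + - (2 * real i + K))" by simp
    also have "\<dots> = a * exp (- (2 * real i + K))" using const by (simp only: exp_add exp_ln)
    finally have "real n * exp (- C * real i) \<le> real n * (a * exp (- (2 * real i + K)))"
      by (intro mult_left_mono) auto
    then show "real n * exp (- C * real i) \<le> \<mu> n i" using lb by (simp add: mult.left_commute)
    have "real n powr (7/8) = exp (ln (real n) + - (ln (real n) / 8))" using n0 by (simp add: powr_def)
    also have "\<dots> = real n * exp (- (ln (real n) / 8))" using n0 by (simp only: exp_add exp_ln)
    also have "\<dots> \<le> real n * exp (- C * real i)" using Ci by (intro mult_left_mono) auto
    finally show "real n powr (7/8) \<le> real n * exp (- C * real i)" .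
  qed
  have low: "real n * exp (- C2 * real i) \<le> f n i x"
    if n: "n \<ge> n1" and i: "1 \<le> i" "real i \<le> c * ln (real n)" and dev: "\<bar>f n i x - \<mu> n i\<bar> \<le> \<epsilon> n * \<mu> n i" for n i x
  proof -
    have \<mu>0: "0 \<le> \<mu> n i" using order.trans[OF _ \<mu>_ge(1)[OF n i], of 0] by simp
    then have "\<epsilon> n * \<mu> n i \<le> 1 / 2 * \<mu> n i" using n1(3)[OF n] by (intro mult_right_mono) auto
    then have half: "\<mu> n i / 2 \<le> f n i x" using dev by linarith
    have "exp (- real i) \<le> exp (-1)" using i by simp
    also have "exp (-1) \<le> (1 / 2 :: real)"
      using exp_ge_add_one_self[of 1] by (simp add: exp_minus field_simps)
    finally have "real n * exp (- C * real i) * exp (- real i) \<le> real n * exp (- C * real i) * (1 / 2)"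
      by (intro mult_left_mono) auto
    also have "real n * exp (- C * real i) * exp (- real i) = real n * exp (- C2 * real i)"
      by (simp add: C2_def exp_add[symmetric] algebra_simps)
    finally show ?thesis using \<mu>_ge(1)[OF n i] half by linarith
  qed
  have up: "f n i x \<le> real n * exp (- C1 * real i)"
    if n: "n \<ge> n1" and i: "2 \<le> i" "real i \<le> c * ln (real n)"
      and dev: "\<And>i. 1 \<le> i \<Longrightarrow> real i \<le> c * ln (real n) \<Longrightarrow> \<bar>f n i x - \<mu> n i\<bar> \<le> \<epsilon> n * \<mu> n i" for n i x
  proof (cases "i0 \<le> real i")
    case True
    have n0: "0 < n" using n1(4)[OF n] by simp
    have i': "1 \<le> i" using i by simp
    have \<mu>0: "0 \<le> \<mu> n i" using order.trans[OF _ \<mu>_ge(1)[OF n i' i(2)], of 0] by simp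
    then have "\<epsilon> n * \<mu> n i \<le> 1 * \<mu> n i" using n1(3)[OF n] by (intro mult_right_mono) auto
    then have "f n i x \<le> 2 * \<mu> n i" using dev[OF i' i(2)] by linarith
    also have "\<mu> n i \<le> exp (- (l * real i)) * (B * real n)"
    proof -
      have "b ^ i = exp (l * real i)" using const by (simp add: l_def exp_of_nat2_mult)
      then show ?thesis using upper[OF n0, of i] by (simp add: exp_minus field_simps)
    qed
    also have "2 * (exp (- (l * real i)) * (B * real n)) = real n * (2 * B * exp (- (l * real i)))" by simp
    also have "\<dots> \<le> real n * exp (- C1 * real i)"
    proof (intro mult_left_mono)
      have "ln (2 * B) \<le> l * real i / 2" using True l by (simp add: i0_def field_simps)
      moreover have "C1 * real i \<le> l / 2 * real i" using C1 by (intro mult_right_mono) auto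
      ultimately have "ln (2 * B) + - (l * real i) \<le> - C1 * real i" by simp
      then have "exp (ln (2 * B)) * exp (- (l * real i)) \<le> exp (- C1 * real i)"
        unfolding exp_add[symmetric] by simp
      then show "2 * B * exp (- (l * real i)) \<le> exp (- C1 * real i)"
        using const by simp
    qed simp
    finally show ?thesis by simp
  next
    case False
    have "real n * exp (- C2 * real 3) \<le> f n 3 x"
      using n1(2)[OF n] dev[of 3] by (intro low[OF n]) auto
    moreover have "f n i x \<le> f n 2 x" using i by (intro antimono)
    ultimately have "f n i x \<le> real n * (1 - exp (- 3 * C2))"
      using f23[of n x] by (simp add: algebra_simps)
    also have "1 - exp (- 3 * C2) = exp (- q)" using C by (simp add: q_def C2_def)
    also have "real n * exp (- q) \<le> real n * exp (- C1 * real i)"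
    proof -
      have "C1 * real i \<le> q / (\<bar>i0\<bar> + 1) * (\<bar>i0\<bar> + 1)" using C1 q False by (intro mult_mono) auto
      then show ?thesis by (intro mult_left_mono) auto
    qed
    finally show ?thesis .
  qed
  have lim: "\<epsilon> \<longlonglongrightarrow> 0" unfolding \<epsilon>_def[abs_def] by real_asymp
  have "asymptotically_almost_surely M
        (\<lambda>n x. \<forall>i::nat. 1 \<le> i \<and> real i \<le> c * ln (real n) \<longrightarrow>
           real n * exp (- C2 * real i) \<le> f n i x \<and>
           (2 \<le> i \<longrightarrow> f n i x \<le> real n * exp (- C1 * real i)) \<and>
           \<bar>f n i x - \<mu> n i\<bar> \<le> \<epsilon> n * \<mu> n i)"
  proof (rule asymptotically_almost_surely_of_variance_bound[where f = f and \<mu> = \<mu> and V = V and c = c and ?n1.0 = n1])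
    show "real n powr (7/8) \<le> \<mu> n i" if "n \<ge> n1" "1 \<le> i" "real i \<le> c * ln (real n)" for n i
      using \<mu>_ge[OF that] by linarith
  qed (use prob meas bounds \<mu> var c low up in \<open>auto simp: \<epsilon>_def\<close>)
  then show ?thesis using C1 c lim by blast
qed

section \<open>Tree degrees and the final assembly\<close>

text \<open>The edges at \<open>v\<close> are one per child and, for \<open>v > 0\<close>, one to
  the parent. They are distinct as sets because the parent precedes \<open>v\<close> and the
  children follow it.\<close>

lemma V_ge_eq_high_degree:
  fixes X :: "nat \<Rightarrow> real ^ 'd::finite"
  shows "V_ge n i X = high_degree (torus_dist n) {} n i X"
proof -
  have near: "nearest_earlier n X v = nearest_in (torus_dist n) {..<v} X v" for v
    unfolding nearest_earlier_def nearest_in_def Ball_def lessThan_iff ..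
  have "NN_degree n X v = card (children (torus_dist n) {} n X v) + of_bool (0 < v)" if "v < n" for v
  proof -
    define p where "p w = nearest_in (torus_dist n) {..<w} X w" for w
    define Ch where "Ch = children (torus_dist n) {} n X v"
    have p: "p w < w" if "0 < w" for w using that by (simp add: p_def nearest_in_less)
    have Ch: "Ch = {w. v < w \<and> w < n \<and> p w = v}"
      by (simp add: Ch_def children_def p_def)
    have fin: "finite Ch" by (simp add: Ch_def)
    let ?P = "if 0 < v then {{p v, v}} else {}"
    have eq: "{e \<in> NN_tree_edges n X. v \<in> e} = (\<lambda>w. {v, w}) ` Ch \<union> ?P"
    proof (intro set_eqI iffI)
      fix e assume "e \<in> {e \<in> NN_tree_edges n X. v \<in> e}"
      then obtain w where w: "e = {p w, w}" "0 < w" "w < n" "v = p w \<or> v = w"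
        by (auto simp: NN_tree_edges_def near p_def)
      show "e \<in> (\<lambda>w. {v, w}) ` Ch \<union> ?P"
      proof (cases "v = w")
        case False
        then have "w \<in> Ch" using w p[of w] by (simp add: Ch)
        then show ?thesis using w False by auto
      qed (use w in auto)
    next
      fix e assume "e \<in> (\<lambda>w. {v, w}) ` Ch \<union> ?P"
      then consider w where "w \<in> Ch" "e = {v, w}" | "0 < v" "e = {p v, v}" by (auto split: if_splits)
      then show "e \<in> {e \<in> NN_tree_edges n X. v \<in> e}"
      proof cases
        case 1
        then have "e = {p w, w}" "1 \<le> w" "w < n" "v \<in> e" by (auto simp: Ch)
        then show ?thesis unfolding NN_tree_edges_def near p_def by blast
      next
        case 2
        then have "e = {p v, v}" "1 \<le> v" "v \<in> e" by auto
        then show ?thesis unfolding NN_tree_edges_def near p_def using \<open>v < n\<close> by blast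
      qed
    qed
    have "(\<lambda>w. {v, w}) ` Ch \<inter> ?P = {}"
      using p[of v] by (auto simp: Ch doubleton_eq_iff split: if_splits)
    moreover have "inj_on (\<lambda>w. {v, w}) Ch" by (auto simp: inj_on_def doubleton_eq_iff)
    ultimately show ?thesis
      unfolding NN_degree_def eq using fin
      by (subst card_Un_disjoint) (auto simp: card_image Ch_def[symmetric])
  qed
  then show ?thesis unfolding V_ge_def high_degree_def by (intro Collect_cong) auto
qed

text \<open>For \<open>n \<ge> 2\<close> every vertex has degree at least 1, so the exponential
  upper bound can only start at \<open>i = 2\<close>. A single error \<open>\<epsilon> n\<close> for
  all \<open>i\<close> in range makes the o(1) uniform.\<close>

theorem theorem1p5:
  shows "\<exists>C1 C2 c :: real. 0 < C1 \<and> C1 < C2 \<and> 0 < c \<and>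
    (\<exists>\<epsilon> :: nat \<Rightarrow> real. \<epsilon> \<longlonglongrightarrow> 0 \<and>
      asymptotically_almost_surely (arrivals :: nat \<Rightarrow> (nat \<Rightarrow> real ^ 'd::finite) measure)
        (\<lambda>n X. \<forall>i::nat. 1 \<le> i \<and> real i \<le> c * ln (real n) \<longrightarrow>
           real n * exp (- C2 * real i) \<le> real (card (V_ge n i X)) \<and>
           (2 \<le> i \<longrightarrow> real (card (V_ge n i X)) \<le> real n * exp (- C1 * real i)) \<and>
           \<bar>real (card (V_ge n i X)) - expected_V_ge TYPE('d) n i\<bar>
             \<le> \<epsilon> n * expected_V_ge TYPE('d) n i))"
proof -
  obtain \<kappa> :: nat where \<kappa>: "0 < \<kappa>"
    "\<And>n (U :: nat set) X (y :: real ^ 'd). finite U \<Longrightarrow> (\<And>u. u \<in> U \<Longrightarrow> 0 < torus_dist n (X u) y) \<Longrightarrow>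
      (\<And>u u'. u \<in> U \<Longrightarrow> u' \<in> U \<Longrightarrow> u \<noteq> u' \<Longrightarrow> torus_dist n (X u) y \<le> torus_dist n (X u) (X u')) \<Longrightarrow> card U \<le> \<kappa>"
    using torus_kissing by blast
  \<comment> \<open>The rate depends on \<open>\<kappa>\<close> alone, so it is one constant for all
    \<open>n\<close>.\<close>
  define b where "b = nn_points.\<beta> \<kappa>"
  have nn: "nn_points (uniform_measure lborel (torus n :: (real ^ 'd) set)) (torus_dist n) \<kappa>" if "0 < n" for n
    by (rule nn_points_torus[OF that \<kappa>])
  have b: "1 < b" unfolding b_def by (rule nn_points.\<beta>_gt_1[OF nn[of 1]]) simp
  have f: "(\<lambda>X :: nat \<Rightarrow> real ^ 'd. real (card (V_ge n i X))) = (\<lambda>X. real (card (high_degree (torus_dist n) {} n i X)))" for n i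
    by (simp add: V_ge_eq_high_degree)
  show ?thesis
  proof (rule concentrated_counts_of_moment_bounds[where f = "\<lambda>n i X. real (card (V_ge n i X))" and b = b
        and V = "3 * (2 + 2 / ln b)\<^sup>2" and B = "3 * b" and K = "24 / ln b" and a = "ln b / 8"])
    fix n i j :: nat and X :: "nat \<Rightarrow> real ^ 'd"
    show "prob_space (arrivals n :: (nat \<Rightarrow> real ^ 'd) measure)" if "0 < n"
      unfolding arrivals_def by (rule nn_points.prob_space_points[OF nn[OF that]])
    show "(\<lambda>X. real (card (V_ge n i X))) \<in> borel_measurable (arrivals n :: (nat \<Rightarrow> real ^ 'd) measure)" if "0 < n"
      unfolding arrivals_def f by (rule nn_points.card_high_degree_measurable[OF nn[OF that]])
    show "real (card (V_ge n i X)) \<le> real n"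
      by (simp add: V_ge_eq_high_degree card_high_degree_le)
    show "real (card (V_ge n j X)) \<le> real (card (V_ge n i X))" if "i \<le> j"
      unfolding V_ge_eq_high_degree using that by (intro of_nat_mono card_mono high_degree_antimono finite_high_degree)
    show "real (card (V_ge n 2 X)) + real (card (V_ge n 3 X)) \<le> real n"
      unfolding V_ge_eq_high_degree of_nat_add[symmetric] of_nat_le_iff by (rule card_high_degree_2_3)
    show "expected_V_ge TYPE('d) n i = (\<integral>X. real (card (V_ge n i X)) \<partial>(arrivals n :: (nat \<Rightarrow> real ^ 'd) measure))"
      by (rule expected_V_ge_def)
    show "(\<integral>X. (real (card (V_ge n i X)))\<^sup>2 \<partial>(arrivals n :: (nat \<Rightarrow> real ^ 'd) measure)) - (expected_V_ge TYPE('d) n i)\<^sup>2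
        \<le> 3 * (2 + 2 / ln b)\<^sup>2 * real n" if "0 < n"
      unfolding expected_V_ge_def arrivals_def V_ge_eq_high_degree b_def
      by (rule nn_points.variance_high_degree_le[OF nn[OF that]])
    show "b ^ i * expected_V_ge TYPE('d) n i \<le> 3 * b * real n" if "0 < n"
      unfolding expected_V_ge_def arrivals_def V_ge_eq_high_degree b_def
      by (rule nn_points.expected_high_degree_le[OF nn[OF that]])
    show "ln b / 8 * (real n * exp (- (2 * real i + 24 / ln b))) \<le> expected_V_ge TYPE('d) n i"
      if "0 < n" "1 \<le> real n * exp (- (2 * real i + 24 / ln b))"
      using that(2) unfolding expected_V_ge_def arrivals_def V_ge_eq_high_degree b_def
      by (rule nn_points.expected_high_degree_ge[OF nn[OF that(1)]])
  qed (use b in auto)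
qed

end
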